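(* Let $k\in\mathbb{N}$. Let $G$ be a residually finite group and let $M$ be a sequence of probability measures on $G$ that measures index uniformly. Let $H_1>H_2>\cdots$ be a sequence of finite-index normal subgroups of $G$ such that $\bigcap_{m=1}^\infty H_m=\{1\}$. Then $\mathrm{dc}^k(G/H_m)\to\mathrm{dc}_M^k(G)$ as $m\to\infty$.
   Context: Groups are discrete. Simple commutators are defined by $[x_1,x_2]=x_1^{-1}x_2^{-1}x_1x_2$ and $[x_1,\ldots,x_k]=[[x_1,\ldots,x_{k-1}],x_k]$. For a probability measure $\mu$ on a group $G$, $\mathrm{dc}^k_\mu(G)$ is the probability that $[x_1,\ldots,x_{k+1}]=1$ when $x_1,\ldots,x_{k+1}$ are chosen independently according to $\mu$. For a finite group $Q$, $\mathrm{dc}^k(Q)$ denotes $\mathrm{dc}^k_\mu(Q)$ with $\mu$ the uniform probability measure on $Q$. For a sequence $M=(\mu_n)_{n=1}^\infty$ of probability measures, $\mathrm{dc}_M^k(G)=\limsup_{n\to\infty}\mathrm{dc}^k_{\mu_n}(G)$. The sequence $M$ measures index uniformly if $\mu_n(xH)\to1/[G:H]$ as $n\to\infty$, uniformly over all $x\in G$ and all subgroups $H$ of $G$, where $1/[G:H]=0$ if $[G:H]=\infty$. *)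

theory Defs
  imports "HOL-Probability.Probability" "HOL-Algebra.Coset"
begin

definition group_commutator :: "('a, 'b) monoid_scheme \<Rightarrow> 'a \<Rightarrow> 'a \<Rightarrow> 'a" where
  "group_commutator G x y = inv\<^bsub>G\<^esub> x \<otimes>\<^bsub>G\<^esub> inv\<^bsub>G\<^esub> y \<otimes>\<^bsub>G\<^esub> x \<otimes>\<^bsub>G\<^esub> y"

text \<open>Entries are indexed from 0, so \<open>simple_commutator G x k\<close> is the left-normed commutator
  \<open>[x 0, \<dots>, x k]\<close> with \<open>k + 1\<close> entries.\<close>

primrec simple_commutator :: "('a, 'b) monoid_scheme \<Rightarrow> (nat \<Rightarrow> 'a) \<Rightarrow> nat \<Rightarrow> 'a" where
  "simple_commutator G x 0 = x 0"
| "simple_commutator G x (Suc k) = group_commutator G (simple_commutator G x k) (x (Suc k))"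

text \<open>Groups are discrete, so a probability measure on a group is defined on all subsets
  of the carrier; it need not be supported on a countable set.\<close>

definition prob_measure_on :: "('a, 'b) monoid_scheme \<Rightarrow> 'a measure \<Rightarrow> bool" where
  "prob_measure_on G \<mu> \<longleftrightarrow> prob_space \<mu> \<and> space \<mu> = carrier G \<and> sets \<mu> = Pow (carrier G)"

text \<open>The independent choice of \<open>x 0, \<dots>, x k\<close> is the \<open>(k + 1)\<close>-fold product measure. For
  uncountable \<open>G\<close> the product sigma-algebra can be smaller than the power set; the event below
  is nevertheless measurable whenever \<open>G\<close> has a sequence of finite-index normal subgroups with
  trivial intersection, because membership of the commutator in any one of these is decided
  by the cosets of the entries.\<close>

definition dc_measure :: "nat \<Rightarrow> 'a measure \<Rightarrow> ('a, 'b) monoid_scheme \<Rightarrow> real" where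
  "dc_measure k \<mu> G =
    measure (Pi\<^sub>M {..k} (\<lambda>_. \<mu>))
      {x \<in> space (Pi\<^sub>M {..k} (\<lambda>_. \<mu>)). simple_commutator G x k = \<one>\<^bsub>G\<^esub>}"

definition dc_finite :: "nat \<Rightarrow> ('a, 'b) monoid_scheme \<Rightarrow> real" where
  "dc_finite k Q = dc_measure k (uniform_count_measure (carrier Q)) Q"

definition dc_limsup :: "nat \<Rightarrow> (nat \<Rightarrow> 'a measure) \<Rightarrow> ('a, 'b) monoid_scheme \<Rightarrow> ereal" where
  "dc_limsup k M G = limsup (\<lambda>n. ereal (dc_measure k (M n) G))"

definition finite_index :: "('a, 'b) monoid_scheme \<Rightarrow> 'a set \<Rightarrow> bool" where
  "finite_index G H \<longleftrightarrow> finite (rcosets\<^bsub>G\<^esub> H)"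

definition inverse_index :: "('a, 'b) monoid_scheme \<Rightarrow> 'a set \<Rightarrow> real" where
  "inverse_index G H = (if finite_index G H then 1 / real (card (rcosets\<^bsub>G\<^esub> H)) else 0)"

definition measures_index_uniformly ::
    "('a, 'b) monoid_scheme \<Rightarrow> (nat \<Rightarrow> 'a measure) \<Rightarrow> bool" where
  "measures_index_uniformly G M \<longleftrightarrow>
    uniform_limit {(x, H). x \<in> carrier G \<and> subgroup H G}
      (\<lambda>n (x, H). measure (M n) (x <#\<^bsub>G\<^esub> H)) (\<lambda>(x, H). inverse_index G H) sequentially"

definition residually_finite :: "('a, 'b) monoid_scheme \<Rightarrow> bool" where
  "residually_finite G \<longleftrightarrow>
    (\<forall>g \<in> carrier G - {\<one>\<^bsub>G\<^esub>}. \<exists>N. N \<lhd> G \<and> finite_index G N \<and> g \<notin> N)"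

end

theory Submission
  imports Defs "HOL-Algebra.Product_Groups"
begin

text \<open>Write \<open>c\<close> for the commutator of \<open>k + 1\<close> entries, \<open>p m\<close> for the degree of nilpotency of
  \<open>G/H m\<close>, and \<open>\<alpha>\<close> for the limit of the decreasing sequence \<open>p\<close>. Since \<open>p m\<close> is the limiting
  probability that \<open>c\<close> lies in \<open>H m\<close>, the upper limit of the probabilities of \<open>c = 1\<close> is at most \<open>\<alpha>\<close>.
  For the converse, let \<open>l \<ge> m\<close> and look at the product cosets of \<open>(H m)^(k + 1)\<close> in \<open>G^(k + 1)\<close>. On
  each of them, \<open>c\<close> lies in \<open>H l\<close> either everywhere or with relative frequency at most
  \<open>1 - 2^-(k + 1)\<close>. So the product cosets on which \<open>c\<close> lies in \<open>H m\<close> but not everywhere in \<open>H l\<close> have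
  total measure at most \<open>2^(k + 1) (p m - p l)\<close>. For large \<open>l\<close>, lying everywhere in \<open>H l\<close> means
  \<open>c = 1\<close> on the whole product coset, so the lower limit of the probabilities of \<open>c = 1\<close> is at least
  \<open>p m - 2^(k + 1) (p m - \<alpha>)\<close>, which tends to \<open>\<alpha>\<close>.

  The zero-one law on product cosets is a statement about a normal subgroup \<open>K\<close> of a finite group.
  If \<open>c = 1\<close> with relative frequency above \<open>1 - 2^-(k + 1)\<close>, then integrating out one variable at a
  time shows that \<open>K\<close> is nilpotent of class at most \<open>k\<close>. With respect to the filtration consisting
  of the whole group followed by the lower central series of \<open>K\<close>, the commutator is a polynomial
  map, and a polynomial map that is trivial with such a frequency is trivial.\<close>

section \<open>Commutators and filtrations\<close>

context group
begin

lemma inv_mult_cancel: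
  "x \<in> carrier G \<Longrightarrow> y \<in> carrier G \<Longrightarrow> inv x \<otimes> (x \<otimes> y) = y"
  "x \<in> carrier G \<Longrightarrow> y \<in> carrier G \<Longrightarrow> x \<otimes> (inv x \<otimes> y) = y"
  by (simp_all flip: m_assoc)

text \<open>With the default rules these bring a word to right-nested, freely reduced form. The
  identities below hold already in free groups, so simplification settles them.\<close>

lemmas group_word_simps = m_assoc inv_mult_group inv_mult_cancel

lemma group_commutator_closed [simp]:
  "x \<in> carrier G \<Longrightarrow> y \<in> carrier G \<Longrightarrow> group_commutator G x y \<in> carrier G"
  by (simp add: group_commutator_def)

lemma conj_eq_mult_commutator:
  assumes "x \<in> carrier G" "y \<in> carrier G"
  shows "inv y \<otimes> x \<otimes> y = x \<otimes> group_commutator G x y"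
  using assms by (simp add: group_commutator_def group_word_simps)

lemma inv_group_commutator:
  assumes "x \<in> carrier G" "y \<in> carrier G"
  shows "inv (group_commutator G x y) = group_commutator G y x"
  using assms by (simp add: group_commutator_def group_word_simps)

lemma group_commutator_mult_left:
  assumes "x \<in> carrier G" "y \<in> carrier G" "z \<in> carrier G"
  shows "group_commutator G (x \<otimes> y) z =
    inv y \<otimes> group_commutator G x z \<otimes> y \<otimes> group_commutator G y z"
  using assms by (simp add: group_commutator_def group_word_simps)

lemma group_commutator_mult_right:
  assumes "x \<in> carrier G" "y \<in> carrier G" "z \<in> carrier G"
  shows "group_commutator G x (y \<otimes> z) =
    group_commutator G x z \<otimes> (inv z \<otimes> group_commutator G x y \<otimes> z)"
  using assms by (simp add: group_commutator_def group_word_simps)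

lemma group_commutator_inv_left:
  assumes "x \<in> carrier G" "y \<in> carrier G"
  shows "group_commutator G (inv x) y = x \<otimes> inv (group_commutator G x y) \<otimes> inv x"
  using assms by (simp add: group_commutator_def group_word_simps)

lemma group_commutator_inv_right:
  assumes "x \<in> carrier G" "y \<in> carrier G"
  shows "group_commutator G x (inv y) = y \<otimes> inv (group_commutator G x y) \<otimes> inv y"
  using assms by (simp add: group_commutator_def group_word_simps)

lemma group_commutator_one [simp]:
  "x \<in> carrier G \<Longrightarrow> group_commutator G x \<one> = \<one>"
  "x \<in> carrier G \<Longrightarrow> group_commutator G \<one> x = \<one>"
  by (simp_all add: group_commutator_def)

text \<open>Checked by free reduction. The cyclic shape lets two of the double commutators control
  the third, which is what the three subgroup argument needs.\<close>

lemma Hall_Witt: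
  assumes "x \<in> carrier G" "y \<in> carrier G" "z \<in> carrier G"
  shows "(inv y \<otimes> group_commutator G (group_commutator G x (inv y)) z \<otimes> y) \<otimes>
     (inv z \<otimes> group_commutator G (group_commutator G y (inv z)) x \<otimes> z) \<otimes>
     (inv x \<otimes> group_commutator G (group_commutator G z (inv x)) y \<otimes> x) = \<one>"
  using assms by (simp add: group_commutator_def group_word_simps)

end

lemma (in group_hom) hom_group_commutator:
  assumes "x \<in> carrier G" "y \<in> carrier G"
  shows "h (group_commutator G x y) = group_commutator H (h x) (h y)"
  using assms by (simp add: group_commutator_def)

text \<open>\<open>F 0\<close> may be larger than \<open>F 1\<close>. This freedom is used later,
  when \<open>F 0\<close> is the whole group and \<open>F 1\<close> the normal subgroup. The case
  \<open>j = 0\<close> says that \<open>F 0\<close> normalises every term.\<close>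

definition group_filtration :: "('a, 'b) monoid_scheme \<Rightarrow> (nat \<Rightarrow> 'a set) \<Rightarrow> bool" where
  "group_filtration G F \<longleftrightarrow> (\<forall>i. subgroup (F i) G \<and> F (Suc i) \<subseteq> F i) \<and>
    (\<forall>i j. \<forall>x \<in> F i. \<forall>y \<in> F j. group_commutator G x y \<in> F (i + j))"

text \<open>With \<open>G\<close> a group of maps and \<open>T\<close> its right shifts, \<open>inv f \<otimes> t f\<close> is a discrete derivative.
  Iterating the construction gives the polynomial maps; that it yields a filtration again is why
  they form a group (the theorem of Lazard and Leibman).\<close>

definition derived_filtration ::
    "('a, 'b) monoid_scheme \<Rightarrow> ('a \<Rightarrow> 'a) set \<Rightarrow> (nat \<Rightarrow> 'a set) \<Rightarrow> nat \<Rightarrow> 'a set" where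
  "derived_filtration G T F i = {f \<in> F i. \<forall>t \<in> T. inv\<^bsub>G\<^esub> f \<otimes>\<^bsub>G\<^esub> t f \<in> F (Suc i)}"

locale filtered_group = group +
  fixes F
  assumes filt: "group_filtration G F"
begin

lemma subgroup_F: "subgroup (F i) G"
  using filt by (simp add: group_filtration_def)

lemma F_closed: "x \<in> F i \<Longrightarrow> x \<in> carrier G"
  by (rule subgroup.mem_carrier[OF subgroup_F])

lemma F_antimono: "i \<le> j \<Longrightarrow> F j \<subseteq> F i"
  by (rule lift_Suc_antimono_le) (use filt in \<open>auto simp: group_filtration_def\<close>)

lemma F_mono: "x \<in> F j \<Longrightarrow> i \<le> j \<Longrightarrow> x \<in> F i"
  using F_antimono by blast

lemma F_mult: "x \<in> F i \<Longrightarrow> y \<in> F i \<Longrightarrow> x \<otimes> y \<in> F i"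
  by (rule subgroup.m_closed[OF subgroup_F])

lemma F_inv: "x \<in> F i \<Longrightarrow> inv x \<in> F i"
  by (rule subgroup.m_inv_closed[OF subgroup_F])

lemma F_one: "\<one> \<in> F i"
  by (rule subgroup.one_closed[OF subgroup_F])

lemma F_commutator: "x \<in> F i \<Longrightarrow> y \<in> F j \<Longrightarrow> group_commutator G x y \<in> F (i + j)"
  using filt by (simp add: group_filtration_def)

lemma F_conj:
  assumes "x \<in> F i" "y \<in> F j"
  shows "inv y \<otimes> x \<otimes> y \<in> F i"
proof -
  have "group_commutator G x y \<in> F i"
    using F_commutator[OF assms] by (rule F_mono) simp
  then have "x \<otimes> group_commutator G x y \<in> F i"
    using assms(1) F_mult by blast
  then show ?thesis
    using conj_eq_mult_commutator[OF F_closed[OF assms(1)] F_closed[OF assms(2)]] by simp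
qed

lemma F_conj':
  assumes "x \<in> F i" "y \<in> F j"
  shows "y \<otimes> x \<otimes> inv y \<in> F i"
  using F_conj[OF assms(1) F_inv[OF assms(2)]] F_closed[OF assms(2)] by simp

text \<open>Changing one argument at a time, from \<open>[a, c]\<close> via
  \<open>t = [a, d]\<close> to \<open>[b, d]\<close>, introduces only commutators with
  \<open>v\<close> or \<open>w\<close> and their conjugates, all of degree at least
  \<open>i + j + 1\<close>. Hence the commutator is well defined on successive quotients.\<close>

lemma commutator_congruent:
  assumes a: "a \<in> F i" and b: "b \<in> F i" and ab: "inv a \<otimes> b \<in> F (Suc i)"
    and c: "c \<in> F j" and d: "d \<in> F j" and cd: "inv c \<otimes> d \<in> F (Suc j)"
  shows "inv (group_commutator G a c) \<otimes> group_commutator G b d \<in> F (Suc (i + j))"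
proof -
  define v w where "v = inv a \<otimes> b" and "w = inv c \<otimes> d"
  define g t where "g = group_commutator G a c" and "t = group_commutator G a d"
  note [simp] = F_closed[OF a] F_closed[OF b] F_closed[OF c] F_closed[OF d]
  have v: "v \<in> F (Suc i)" and w: "w \<in> F (Suc j)"
    using ab cd by (auto simp: v_def w_def)
  note [simp] = F_closed[OF v] F_closed[OF w]
  have bv: "b = a \<otimes> v" and dw: "d = c \<otimes> w"
    by (simp_all add: v_def w_def group_word_simps)
  have g: "g \<in> F (i + j)" and t: "t \<in> F (i + j)"
    using F_commutator a c d by (auto simp: g_def t_def)
  note [simp] = F_closed[OF g] F_closed[OF t]
  have "inv g \<otimes> t = (inv g \<otimes> group_commutator G a w \<otimes> g) \<otimes> group_commutator G g w"
    unfolding t_def dw by (simp add: group_commutator_mult_right flip: g_def)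
      (simp add: group_commutator_def group_word_simps)
  also have "\<dots> \<in> F (Suc (i + j))"
  proof (rule F_mult)
    show "inv g \<otimes> group_commutator G a w \<otimes> g \<in> F (Suc (i + j))"
      using F_conj[OF F_commutator[OF a w] g] by simp
    show "group_commutator G g w \<in> F (Suc (i + j))"
      using F_commutator[OF g w] by (rule F_mono) simp
  qed
  finally have 1: "inv g \<otimes> t \<in> F (Suc (i + j))" .
  have "inv t \<otimes> group_commutator G b d = group_commutator G t v \<otimes> group_commutator G v d"
    unfolding bv by (simp add: group_commutator_mult_left flip: t_def)
      (simp add: group_commutator_def group_word_simps)
  also have "\<dots> \<in> F (Suc (i + j))"
  proof (rule F_mult)
    show "group_commutator G t v \<in> F (Suc (i + j))"
      using F_commutator[OF t v] by (rule F_mono) simp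
    show "group_commutator G v d \<in> F (Suc (i + j))"
      using F_commutator[OF v d] by simp
  qed
  finally have "inv t \<otimes> group_commutator G b d \<in> F (Suc (i + j))" .
  from F_mult[OF 1 this] show ?thesis
    by (simp add: g_def[symmetric] group_word_simps)
qed

text \<open>As each \<open>t\<close> is a homomorphism, it maps a commutator to the commutator of
  the images, and \<open>commutator_congruent\<close> compares the two. Products and inverses only
  need that conjugation preserves the terms of \<open>F\<close>.\<close>

lemma filtration_derived:
  assumes T: "T \<subseteq> hom G G"
  shows "group_filtration G (derived_filtration G T F)"
proof -
  let ?D = "derived_filtration G T F"
  have hom: "group_hom G G t" if "t \<in> T" for t
    using that T is_group by (auto simp: group_hom_def group_hom_axioms_def)
  \<comment> \<open>For elements of the derived term, \<open>t\<close> is known to map into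
    \<open>F i\<close>. This supplies the arguments \<open>b\<close> and \<open>d\<close> of
    \<open>commutator_congruent\<close>.\<close>
  have shift: "t f \<in> F i" if f: "f \<in> ?D i" and t: "t \<in> T" for f t i
  proof -
    interpret group_hom G G t by (rule hom[OF t])
    have "f \<in> F i" "inv f \<otimes> t f \<in> F i"
      using f t F_antimono[of i "Suc i"] by (auto simp: derived_filtration_def)
    from F_mult[OF this] show ?thesis
      using F_closed[OF \<open>f \<in> F i\<close>] by (simp add: group_word_simps)
  qed
  have D: "f \<in> F i" "t \<in> T \<Longrightarrow> inv f \<otimes> t f \<in> F (Suc i)" if "f \<in> ?D i" for f t i
    using that by (auto simp: derived_filtration_def)
  have "subgroup (?D i) G" for i
  proof (rule subgroupI)
    show "?D i \<subseteq> carrier G"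
      using D(1) F_closed by (meson subsetI)
    have "inv \<one> \<otimes> t \<one> \<in> F (Suc i)" if "t \<in> T" for t
      using group_hom.hom_one[OF hom[OF that]] F_one by simp
    then have "\<one> \<in> ?D i"
      by (simp add: derived_filtration_def F_one)
    then show "?D i \<noteq> {}" by blast
  next
    fix f assume f: "f \<in> ?D i"
    show "inv f \<in> ?D i"
      unfolding derived_filtration_def
    proof (intro CollectI conjI ballI)
      show "inv f \<in> F i" by (rule F_inv[OF D(1)[OF f]])
      fix t assume t: "t \<in> T"
      interpret group_hom G G t by (rule hom[OF t])
      have "f \<otimes> inv (inv f \<otimes> t f) \<otimes> inv f \<in> F (Suc i)"
        using F_conj'[OF F_inv[OF D(2)[OF f t]] D(1)[OF f]] .
      then show "inv (inv f) \<otimes> t (inv f) \<in> F (Suc i)"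
        using F_closed[OF D(1)[OF f]] by (simp add: group_word_simps)
    qed
  next
    fix f g assume f: "f \<in> ?D i" and g: "g \<in> ?D i"
    show "f \<otimes> g \<in> ?D i"
      unfolding derived_filtration_def
    proof (intro CollectI conjI ballI)
      show "f \<otimes> g \<in> F i" by (rule F_mult[OF D(1)[OF f] D(1)[OF g]])
      fix t assume t: "t \<in> T"
      interpret group_hom G G t by (rule hom[OF t])
      have "(inv g \<otimes> (inv f \<otimes> t f) \<otimes> g) \<otimes> (inv g \<otimes> t g) \<in> F (Suc i)"
        by (rule F_mult[OF F_conj[OF D(2)[OF f t] D(1)[OF g]] D(2)[OF g t]])
      then show "inv (f \<otimes> g) \<otimes> t (f \<otimes> g) \<in> F (Suc i)"
        using F_closed[OF D(1)[OF f]] F_closed[OF D(1)[OF g]] by (simp add: group_word_simps)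
    qed
  qed
  moreover have "?D (Suc i) \<subseteq> ?D i" for i
    using F_antimono[of i "Suc i"] F_antimono[of "Suc i" "Suc (Suc i)"]
    by (auto simp: derived_filtration_def)
  moreover have "group_commutator G f g \<in> ?D (i + j)" if f: "f \<in> ?D i" and g: "g \<in> ?D j" for f g i j
    unfolding derived_filtration_def
  proof (intro CollectI conjI ballI)
    show "group_commutator G f g \<in> F (i + j)"
      by (rule F_commutator[OF D(1)[OF f] D(1)[OF g]])
    fix t assume t: "t \<in> T"
    interpret group_hom G G t by (rule hom[OF t])
    show "inv (group_commutator G f g) \<otimes> t (group_commutator G f g) \<in> F (Suc (i + j))"
      using commutator_congruent[OF D(1)[OF f] shift[OF f t] D(2)[OF f t]
          D(1)[OF g] shift[OF g t] D(2)[OF g t]] F_closed[OF D(1)[OF f]] F_closed[OF D(1)[OF g]]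
      by (simp add: hom_group_commutator)
  qed
  ultimately show ?thesis
    by (simp add: group_filtration_def)
qed

end

section \<open>Polynomial maps into a filtered group\<close>

lemma (in group) bij_betw_mult_right:
  "u \<in> carrier G \<Longrightarrow> bij_betw (\<lambda>h. h \<otimes> u) (carrier G) (carrier G)"
  by (rule bij_betwI[where g = "\<lambda>h. h \<otimes> inv u"]) (auto simp: m_assoc)

lemma (in group) card_mult_right:
  assumes "u \<in> carrier G"
  shows "card {h \<in> carrier G. P (h \<otimes> u)} = card {h \<in> carrier G. P h}"
proof (rule bij_betw_same_card)
  show "bij_betw (\<lambda>h. h \<otimes> u) {h \<in> carrier G. P (h \<otimes> u)} {h \<in> carrier G. P h}"
    using bij_betw_mult_right[OF assms] assms
    by (auto simp: bij_betw_def inj_on_def image_iff)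
qed

text \<open>The set where \<open>P\<close> fails and its translate have equal size, less than half
  of the group, so together they do not cover it.\<close>

lemma (in group) exists_mult_right_both:
  assumes fin: "finite (carrier G)" and v: "v \<in> carrier G"
    and card: "card {h \<in> carrier G. \<not> P h} * 2 < card (carrier G)"
  shows "\<exists>u \<in> carrier G. P u \<and> P (u \<otimes> v)"
proof (rule ccontr)
  assume "\<not> ?thesis"
  then have "carrier G \<subseteq> {h \<in> carrier G. \<not> P h} \<union> {h \<in> carrier G. \<not> P (h \<otimes> v)}"
    by auto
  then have "card (carrier G) \<le> card ({h \<in> carrier G. \<not> P h} \<union> {h \<in> carrier G. \<not> P (h \<otimes> v)})"
    using fin by (intro card_mono) auto
  also have "\<dots> \<le> card {h \<in> carrier G. \<not> P h} + card {h \<in> carrier G. \<not> P (h \<otimes> v)}"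
    by (rule card_Un_le)
  finally show False
    using card card_mult_right[OF v, of "\<lambda>h. \<not> P h"] by simp
qed

definition right_shift :: "('v, 'c) monoid_scheme \<Rightarrow> 'v \<Rightarrow> ('v \<Rightarrow> 'a) \<Rightarrow> 'v \<Rightarrow> 'a" where
  "right_shift V u f = (\<lambda>h \<in> carrier V. f (h \<otimes>\<^bsub>V\<^esub> u))"

text \<open>Unfolding the recursion, \<open>f\<close> is a member if and only if for every
  \<open>j \<le> n\<close> all its \<open>j\<close>-fold derivatives take values in
  \<open>F (i + j)\<close>. So \<open>n\<close> bounds the number of derivatives tested, and
  \<open>i\<close> shifts the degree.\<close>

definition polynomial_maps :: "('v, 'c) monoid_scheme \<Rightarrow> ('a, 'b) monoid_scheme \<Rightarrow>
    (nat \<Rightarrow> 'a set) \<Rightarrow> nat \<Rightarrow> nat \<Rightarrow> ('v \<Rightarrow> 'a) set" where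
  "polynomial_maps V G F n =
    (derived_filtration (product_group (carrier V) (\<lambda>_. G)) (right_shift V ` carrier V) ^^ n)
      (\<lambda>i. carrier V \<rightarrow>\<^sub>E F i)"

section \<open>The group of maps and its polynomial subgroups\<close>

locale filtered_maps = filtered_group G F + V: group V
  for V :: "('v, 'c) monoid_scheme" and G :: "('a, 'b) monoid_scheme" (structure) and F
begin

abbreviation maps :: "('v \<Rightarrow> 'a) monoid" where
  "maps \<equiv> product_group (carrier V) (\<lambda>_. G)"

lemma group_maps: "group maps"
  using is_group by simp

lemma right_shift_hom:
  assumes u: "u \<in> carrier V"
  shows "right_shift V u \<in> hom maps maps"
proof (rule homI)
  fix f assume "f \<in> carrier maps"
  then show "right_shift V u f \<in> carrier maps"
    using u by (auto simp: right_shift_def PiE_iff)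
next
  fix f g assume "f \<in> carrier maps" "g \<in> carrier maps"
  then show "right_shift V u (f \<otimes>\<^bsub>maps\<^esub> g) = right_shift V u f \<otimes>\<^bsub>maps\<^esub> right_shift V u g"
    using u by (auto simp: right_shift_def intro!: restrict_ext)
qed

lemma polynomial_maps_0: "polynomial_maps V G F 0 i = (carrier V \<rightarrow>\<^sub>E F i)"
  by (simp add: polynomial_maps_def)

lemma polynomial_maps_Suc:
  "polynomial_maps V G F (Suc n) =
    derived_filtration maps (right_shift V ` carrier V) (polynomial_maps V G F n)"
  by (simp add: polynomial_maps_def)

lemma commutator_maps:
  assumes "f \<in> carrier maps" "g \<in> carrier maps"
  shows "group_commutator maps f g = (\<lambda>h \<in> carrier V. group_commutator G (f h) (g h))"
  using assms is_group
  by (simp add: group_commutator_def fun_eq_iff)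

lemma filtration_PiE: "group_filtration maps (\<lambda>i. carrier V \<rightarrow>\<^sub>E F i)"
proof -
  have "subgroup (carrier V \<rightarrow>\<^sub>E F i) maps" for i
  proof (rule group.subgroupI[OF group_maps])
    show sub: "(carrier V \<rightarrow>\<^sub>E F i) \<subseteq> carrier maps"
      using F_closed by (auto simp: PiE_iff)
    have "\<one>\<^bsub>maps\<^esub> \<in> (carrier V \<rightarrow>\<^sub>E F i)"
      using F_one by auto
    then show "(carrier V \<rightarrow>\<^sub>E F i) \<noteq> {}" by blast
    fix f assume f: "f \<in> carrier V \<rightarrow>\<^sub>E F i"
    have "f \<in> carrier V \<rightarrow>\<^sub>E carrier G"
      using f sub by auto
    then have "inv\<^bsub>maps\<^esub> f = (\<lambda>h \<in> carrier V. inv f h)"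
      using is_group by simp
    then show "inv\<^bsub>maps\<^esub> f \<in> carrier V \<rightarrow>\<^sub>E F i"
      using f F_inv by (auto simp: PiE_iff)
    fix g assume g: "g \<in> carrier V \<rightarrow>\<^sub>E F i"
    then show "f \<otimes>\<^bsub>maps\<^esub> g \<in> carrier V \<rightarrow>\<^sub>E F i"
      using f F_mult by (auto simp: PiE_iff)
  qed
  moreover have "(carrier V \<rightarrow>\<^sub>E F (Suc i)) \<subseteq> (carrier V \<rightarrow>\<^sub>E F i)" for i
    using F_antimono[of i "Suc i"] by (intro PiE_mono) auto
  moreover have "group_commutator maps f g \<in> carrier V \<rightarrow>\<^sub>E F (i + j)"
    if f: "f \<in> carrier V \<rightarrow>\<^sub>E F i" and g: "g \<in> carrier V \<rightarrow>\<^sub>E F j" for f g i j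
  proof -
    have "f \<in> carrier maps" "g \<in> carrier maps"
      using f g F_closed by (auto simp: PiE_iff)
    then show ?thesis
      using f g F_commutator by (auto simp: commutator_maps PiE_iff)
  qed
  ultimately show ?thesis
    by (simp add: group_filtration_def del: carrier_product_group)
qed

text \<open>Shifts are homomorphisms of the group of maps, and a derived filtration is again a
  filtration, so the construction can be iterated. Polynomial maps are therefore closed under
  products and commutators.\<close>

lemma filtration_polynomial_maps: "group_filtration maps (polynomial_maps V G F n)"
proof (induction n)
  case 0
  then show ?case
    using filtration_PiE by (simp add: polynomial_maps_def)
next
  case (Suc n)
  interpret P: filtered_group maps "polynomial_maps V G F n"
    using group_maps Suc by (simp add: filtered_group_def filtered_group_axioms_def)
  show ?case
    unfolding polynomial_maps_Suc
    by (rule P.filtration_derived) (use right_shift_hom in blast)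
qed

lemma polynomial_maps_filtered_group: "filtered_group maps (polynomial_maps V G F n)"
  using group_maps filtration_polynomial_maps
  by (simp add: filtered_group_def filtered_group_axioms_def)

lemma polynomial_maps_carrier: "f \<in> polynomial_maps V G F n i \<Longrightarrow> f \<in> carrier V \<rightarrow>\<^sub>E carrier G"
  using filtered_group.F_closed[OF polynomial_maps_filtered_group] by simp

lemma polynomial_maps_SucI:
  assumes "f \<in> polynomial_maps V G F n i"
    and "\<And>u. u \<in> carrier V \<Longrightarrow>
      (\<lambda>h \<in> carrier V. inv (f h) \<otimes> f (h \<otimes>\<^bsub>V\<^esub> u)) \<in> polynomial_maps V G F n (Suc i)"
  shows "f \<in> polynomial_maps V G F (Suc n) i"
  unfolding polynomial_maps_Suc derived_filtration_def
proof (intro CollectI conjI ballI)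
  show "f \<in> polynomial_maps V G F n i" by fact
  fix t :: "('v \<Rightarrow> 'a) \<Rightarrow> 'v \<Rightarrow> 'a" assume "t \<in> right_shift V ` carrier V"
  then obtain u where u: "u \<in> carrier V" "t = right_shift V u" by blast
  have "inv\<^bsub>maps\<^esub> f \<otimes>\<^bsub>maps\<^esub> t f = (\<lambda>h \<in> carrier V. inv (f h) \<otimes> f (h \<otimes>\<^bsub>V\<^esub> u))"
    using polynomial_maps_carrier[OF assms(1)] is_group u
    by (simp add: right_shift_def fun_eq_iff)
  then show "inv\<^bsub>maps\<^esub> f \<otimes>\<^bsub>maps\<^esub> t f \<in> polynomial_maps V G F n (Suc i)"
    using assms(2)[OF u(1)] by simp
qed

lemma polynomial_maps_SucD:
  assumes f: "f \<in> polynomial_maps V G F (Suc n) i" and u: "u \<in> carrier V"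
  shows "(\<lambda>h \<in> carrier V. inv (f h) \<otimes> f (h \<otimes>\<^bsub>V\<^esub> u)) \<in> polynomial_maps V G F n (Suc i)"
proof -
  have "inv\<^bsub>maps\<^esub> f \<otimes>\<^bsub>maps\<^esub> right_shift V u f = (\<lambda>h \<in> carrier V. inv (f h) \<otimes> f (h \<otimes>\<^bsub>V\<^esub> u))"
    using polynomial_maps_carrier[OF f] is_group u
    by (simp add: right_shift_def fun_eq_iff)
  then show ?thesis
    using f u by (auto simp: polynomial_maps_Suc derived_filtration_def simp del: inv_product_group)
qed

lemma polynomial_maps_const:
  "a \<in> F i \<Longrightarrow> (\<lambda>h \<in> carrier V. a) \<in> polynomial_maps V G F n i"
proof (induction n arbitrary: a i)
  case 0
  then show ?case by (auto simp: polynomial_maps_0)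
next
  case (Suc n)
  show ?case
  proof (rule polynomial_maps_SucI)
    show "(\<lambda>h \<in> carrier V. a) \<in> polynomial_maps V G F n i"
      using Suc by blast
    fix u assume u: "u \<in> carrier V"
    have "(\<lambda>h \<in> carrier V. inv ((\<lambda>h \<in> carrier V. a) h) \<otimes> (\<lambda>h \<in> carrier V. a) (h \<otimes>\<^bsub>V\<^esub> u)) =
        (\<lambda>h \<in> carrier V. \<one>)"
      using u F_closed[OF Suc.prems] by (auto intro!: restrict_ext)
    then show "(\<lambda>h \<in> carrier V. inv ((\<lambda>h \<in> carrier V. a) h) \<otimes> (\<lambda>h \<in> carrier V. a) (h \<otimes>\<^bsub>V\<^esub> u))
        \<in> polynomial_maps V G F n (Suc i)"
      by (rule ssubst) (rule Suc.IH[OF F_one])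
  qed
qed

text \<open>The derivative in direction \<open>u\<close> is the constant \<open>\<phi> u\<close>,
  which lies in \<open>F 1\<close> as a first derivative must; further derivatives are
  trivial.\<close>

lemma polynomial_maps_hom:
  assumes hom: "\<phi> \<in> hom V G" and F1: "\<phi> ` carrier V \<subseteq> F 1"
  shows "restrict \<phi> (carrier V) \<in> polynomial_maps V G F n 0"
proof (induction n)
  case 0
  then show ?case
    using F1 F_antimono[of 0 1] by (fastforce simp: polynomial_maps_0)
next
  case (Suc n)
  show ?case
  proof (rule polynomial_maps_SucI[OF Suc])
    fix u assume u: "u \<in> carrier V"
    have "(\<lambda>h \<in> carrier V. inv (restrict \<phi> (carrier V) h) \<otimes> restrict \<phi> (carrier V) (h \<otimes>\<^bsub>V\<^esub> u)) =
        (\<lambda>h \<in> carrier V. \<phi> u)"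
      using u hom by (auto intro!: restrict_ext simp: hom_def Pi_iff group_word_simps)
    then show "(\<lambda>h \<in> carrier V. inv (restrict \<phi> (carrier V) h) \<otimes>
        restrict \<phi> (carrier V) (h \<otimes>\<^bsub>V\<^esub> u)) \<in> polynomial_maps V G F n (Suc 0)"
      using polynomial_maps_const[of "\<phi> u" 1] F1 u by auto
  qed
qed

text \<open>A derivative in direction \<open>u\<close> can be bad at \<open>h\<close> only if
  \<open>f\<close> is bad at \<open>h\<close> or at \<open>h u\<close>, so the bad set at most
  doubles while one factor 2 is used up. By induction all derivatives are good everywhere, so
  \<open>f\<close> is constant modulo \<open>F (i + n)\<close>, and one good point decides.\<close>

lemma polynomial_maps_zero_one:
  assumes "finite (carrier V)" "f \<in> polynomial_maps V G F n i"
    and "card {h \<in> carrier V. f h \<notin> F (i + n)} * 2 ^ n < card (carrier V)" and "h \<in> carrier V"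
  shows "f h \<in> F (i + n)"
  using assms(2-4)
proof (induction n arbitrary: f i h)
  case 0
  then show ?case by (auto simp: polynomial_maps_0)
next
  case (Suc n)
  let ?N = "F (i + Suc n)" and ?B = "{h \<in> carrier V. f h \<notin> F (i + Suc n)}"
  have f: "f x \<in> carrier G" if "x \<in> carrier V" for x
    using polynomial_maps_carrier[OF Suc.prems(1)] that by auto
  have diff: "inv (f x) \<otimes> f (x \<otimes>\<^bsub>V\<^esub> u) \<in> ?N" if x: "x \<in> carrier V" and u: "u \<in> carrier V" for x u
  proof -
    let ?g = "\<lambda>h \<in> carrier V. inv (f h) \<otimes> f (h \<otimes>\<^bsub>V\<^esub> u)"
    have "?g h \<in> ?N" if "h \<in> carrier V" "f h \<in> ?N" "f (h \<otimes>\<^bsub>V\<^esub> u) \<in> ?N" for h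
      using that F_inv F_mult by auto
    then have "{h \<in> carrier V. ?g h \<notin> F (Suc i + n)} \<subseteq> ?B \<union> {h \<in> carrier V. f (h \<otimes>\<^bsub>V\<^esub> u) \<notin> ?N}"
      by auto
    then have "card {h \<in> carrier V. ?g h \<notin> F (Suc i + n)} \<le>
        card (?B \<union> {h \<in> carrier V. f (h \<otimes>\<^bsub>V\<^esub> u) \<notin> ?N})"
      using assms(1) by (intro card_mono) auto
    also have "\<dots> \<le> card ?B + card {h \<in> carrier V. f (h \<otimes>\<^bsub>V\<^esub> u) \<notin> ?N}"
      by (rule card_Un_le)
    also have "\<dots> = card ?B * 2"
      using V.card_mult_right[OF u, of "\<lambda>h. f h \<notin> ?N"] by simp
    finally have "card {h \<in> carrier V. ?g h \<notin> F (Suc i + n)} * 2 ^ n \<le> card ?B * 2 ^ Suc n"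
      by simp
    with Suc.prems(2) have "card {h \<in> carrier V. ?g h \<notin> F (Suc i + n)} * 2 ^ n < card (carrier V)"
      by (rule order.strict_trans1[rotated])
    from Suc.IH[OF polynomial_maps_SucD[OF Suc.prems(1) u] this x] show ?thesis
      using x by simp
  qed
  have "card ?B \<le> card ?B * 2 ^ Suc n" by simp
  with Suc.prems(2) have "card ?B < card (carrier V)" by linarith
  then have "?B \<noteq> carrier V" by (metis less_irrefl)
  then obtain x where x: "x \<in> carrier V" "f x \<in> ?N" by auto
  \<comment> \<open>The direction \<open>inv x \<otimes> h\<close> leads from the good point
    \<open>x\<close> to the given point \<open>h\<close>.\<close>
  have "f x \<otimes> (inv (f x) \<otimes> f (x \<otimes>\<^bsub>V\<^esub> (inv\<^bsub>V\<^esub> x \<otimes>\<^bsub>V\<^esub> h))) \<in> ?N"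
    by (rule F_mult[OF x(2) diff[OF x(1)]]) (use x(1) Suc.prems(3) in simp)
  then show ?case
    using x Suc.prems(3) f by (simp add: V.inv_mult_cancel inv_mult_cancel)
qed

end

section \<open>The lower central series of a normal subgroup\<close>

lemma (in normal) commutator_mem:
  assumes "x \<in> carrier G" "h \<in> H"
  shows "group_commutator G h x \<in> H" "group_commutator G x h \<in> H"
proof -
  have "inv h \<otimes> (inv x \<otimes> h \<otimes> x) \<in> H"
    by (intro subgroup.m_closed[OF subgroup_axioms] subgroup.m_inv_closed[OF subgroup_axioms]
        inv_op_closed1 assms)
  then show *: "group_commutator G h x \<in> H"
    using assms by (simp add: group_commutator_def group_word_simps)
  show "group_commutator G x h \<in> H"
    using subgroup.m_inv_closed[OF subgroup_axioms *] assms by (simp add: inv_group_commutator)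
qed

text \<open>The index is one less than in the usual numbering: a subgroup \<open>K\<close> is
  nilpotent of class at most \<open>n\<close> exactly when the term with index \<open>n\<close> is
  trivial.\<close>

primrec lower_central :: "('a, 'b) monoid_scheme \<Rightarrow> 'a set \<Rightarrow> nat \<Rightarrow> 'a set" where
  "lower_central G K 0 = K"
| "lower_central G K (Suc n) =
    generate G {group_commutator G x y | x y. x \<in> lower_central G K n \<and> y \<in> K}"

context normal
begin

text \<open>Conjugation by an element of \<open>G\<close> preserves \<open>H\<close> and, by
  induction, the previous term, so it maps generating commutators to generating commutators.\<close>

lemma normal_lower_central: "lower_central G H n \<lhd> G"
proof (induction n)
  case 0
  show ?case by (simp add: normal_axioms)
next
  case (Suc n)
  interpret L: normal "lower_central G H n" G by (rule Suc)
  have conj: "g \<otimes> group_commutator G x y \<otimes> inv g =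
      group_commutator G (g \<otimes> x \<otimes> inv g) (g \<otimes> y \<otimes> inv g)"
    if "g \<in> carrier G" "x \<in> carrier G" "y \<in> carrier G" for g x y
    using that by (simp add: group_commutator_def group_word_simps)
  show ?case
    unfolding lower_central.simps
  proof (rule normal_generateI)
    show "{group_commutator G x y |x y. x \<in> lower_central G H n \<and> y \<in> H} \<subseteq> carrier G"
      by auto
    fix h g assume "h \<in> {group_commutator G x y |x y. x \<in> lower_central G H n \<and> y \<in> H}"
      and g: "g \<in> carrier G"
    then obtain x y where xy: "x \<in> lower_central G H n" "y \<in> H" "h = group_commutator G x y" by blast
    have "g \<otimes> h \<otimes> inv g = group_commutator G (g \<otimes> x \<otimes> inv g) (g \<otimes> y \<otimes> inv g)"
      using conj[OF g L.mem_carrier[OF xy(1)] mem_carrier[OF xy(2)]] xy(3) by simp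
    moreover have "g \<otimes> x \<otimes> inv g \<in> lower_central G H n" "g \<otimes> y \<otimes> inv g \<in> H"
      using g xy by (auto intro: L.inv_op_closed2 inv_op_closed2)
    ultimately show "g \<otimes> h \<otimes> inv g \<in>
        {group_commutator G x y |x y. x \<in> lower_central G H n \<and> y \<in> H}"
      by blast
  qed
qed

lemma lower_central_carrier: "x \<in> lower_central G H n \<Longrightarrow> x \<in> carrier G"
  by (rule subgroup.mem_carrier[OF normal_imp_subgroup[OF normal_lower_central]])

lemma commutator_lower_central_Suc:
  "x \<in> lower_central G H n \<Longrightarrow> y \<in> H \<Longrightarrow> group_commutator G x y \<in> lower_central G H (Suc n)"
  by (auto intro!: generate.incl)

lemma lower_central_antimono_Suc: "lower_central G H (Suc n) \<subseteq> lower_central G H n"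
proof -
  interpret L: normal "lower_central G H n" G by (rule normal_lower_central)
  show ?thesis
    unfolding lower_central.simps
    by (rule generate_subgroup_incl[OF _ L.subgroup_axioms]) (auto intro: L.commutator_mem)
qed

text \<open>This is the preimage of the centraliser of the image of \<open>A\<close> in
  \<open>G/N\<close>. Being a subgroup, it contains a generated subgroup as soon as it contains the
  generators.\<close>

lemma commutator_right_subgroup:
  assumes "N \<lhd> G" "A \<subseteq> carrier G"
  shows "subgroup {y \<in> carrier G. \<forall>a \<in> A. group_commutator G a y \<in> N} G"
proof -
  interpret N: normal N G by fact
  show ?thesis
    by (rule subgroupI)
      (use assms(2) in \<open>auto simp: group_commutator_mult_right group_commutator_inv_right subset_iff
        intro!: N.m_closed N.inv_op_closed1 N.inv_op_closed2\<close>)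
qed

text \<open>In the Hall-Witt identity for \<open>a\<close>, \<open>b\<close>, \<open>inv c\<close>
  the outer factors \<open>p\<close> and \<open>r\<close> lie in \<open>N\<close>, and the middle
  one is a conjugate of \<open>[[b, c], a]\<close>.\<close>

lemma three_subgroup_element:
  assumes N: "N \<lhd> G" and abc: "a \<in> carrier G" "b \<in> carrier G" "c \<in> carrier G"
    and 1: "group_commutator G (group_commutator G a (inv b)) (inv c) \<in> N"
    and 2: "group_commutator G (group_commutator G (inv c) (inv a)) b \<in> N"
  shows "group_commutator G a (group_commutator G b c) \<in> N"
proof -
  interpret N: normal N G by fact
  define p where "p = inv b \<otimes> group_commutator G (group_commutator G a (inv b)) (inv c) \<otimes> b"
  define r where "r = inv a \<otimes> group_commutator G (group_commutator G (inv c) (inv a)) b \<otimes> a"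
  define g where "g = group_commutator G (group_commutator G b c) a"
  have pr: "p \<in> N" "r \<in> N"
    using 1 2 abc by (auto simp: p_def r_def intro: N.inv_op_closed1)
  have [simp]: "g \<in> carrier G" "p \<in> carrier G" "r \<in> carrier G"
    using abc pr by (simp_all add: g_def)
  have "p \<otimes> (c \<otimes> g \<otimes> inv c) \<otimes> r = \<one>"
    using Hall_Witt[of a b "inv c"] abc by (simp add: p_def r_def g_def)
  moreover have "g = inv c \<otimes> (inv p \<otimes> (p \<otimes> (c \<otimes> g \<otimes> inv c) \<otimes> r) \<otimes> inv r) \<otimes> c"
    using abc by (simp add: group_word_simps)
  ultimately have "g = inv c \<otimes> (inv p \<otimes> \<one> \<otimes> inv r) \<otimes> c"
    by simp
  also have "\<dots> \<in> N"
    using pr abc by (intro N.inv_op_closed1 N.m_closed N.m_inv_closed N.one_closed)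
  finally have "inv g \<in> N" by (rule N.m_inv_closed)
  then show ?thesis
    using abc by (simp add: inv_group_commutator g_def)
qed

text \<open>Induction on \<open>j\<close> for all \<open>i\<close> at once, applying the three
  subgroup lemma to a generator \<open>[b, c]\<close> of the term \<open>j + 1\<close>. Here
  \<open>[a, inv b]\<close> has index \<open>i + j + 1\<close>, raised by one by
  \<open>inv c\<close>; and \<open>[inv c, inv a]\<close> has index \<open>i + 1\<close>, where the
  induction hypothesis applies with \<open>b\<close>. The extra \<open>Suc\<close> comes from
  numbering the series from 0.\<close>

lemma commutator_lower_central:
  "x \<in> lower_central G H i \<Longrightarrow> y \<in> lower_central G H j \<Longrightarrow>
    group_commutator G x y \<in> lower_central G H (Suc (i + j))"
proof (induction j arbitrary: i x y)
  case 0
  then show ?case using commutator_lower_central_Suc by simp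
next
  case (Suc j)
  define N where "N = lower_central G H (Suc (i + Suc j))"
  have N: "N \<lhd> G" unfolding N_def by (rule normal_lower_central)
  have inv: "inv z \<in> lower_central G H n" if "z \<in> lower_central G H n" for z n
    by (rule subgroup.m_inv_closed[OF normal_imp_subgroup[OF normal_lower_central] that])
  have "lower_central G H (Suc j) \<subseteq>
      {y \<in> carrier G. \<forall>a \<in> lower_central G H i. group_commutator G a y \<in> N}"
    unfolding lower_central.simps
  proof (rule generate_subgroup_incl)
    show "subgroup {y \<in> carrier G. \<forall>a \<in> lower_central G H i. group_commutator G a y \<in> N} G"
      using lower_central_carrier by (intro commutator_right_subgroup[OF N]) blast
    have "group_commutator G a (group_commutator G b c) \<in> N"
      if a: "a \<in> lower_central G H i" and b: "b \<in> lower_central G H j" and c: "c \<in> H" for a b c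
    proof (rule three_subgroup_element[OF N])
      show "a \<in> carrier G" "b \<in> carrier G" "c \<in> carrier G"
        using a b c lower_central_carrier by auto
      show "group_commutator G (group_commutator G a (inv b)) (inv c) \<in> N"
        using commutator_lower_central_Suc[OF Suc.IH[OF a inv[OF b]]] c by (simp add: N_def)
      have "group_commutator G (inv a) (inv c) \<in> lower_central G H (Suc i)"
        by (intro commutator_lower_central_Suc inv a c subgroup.m_inv_closed[OF subgroup_axioms])
      then have "inv (group_commutator G (inv a) (inv c)) \<in> lower_central G H (Suc i)"
        by (rule inv)
      then have "group_commutator G (inv c) (inv a) \<in> lower_central G H (Suc i)"
        using a c lower_central_carrier by (simp add: inv_group_commutator)
      from Suc.IH[OF this b]
      show "group_commutator G (group_commutator G (inv c) (inv a)) b \<in> N"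
        by (simp add: N_def)
    qed
    then show "{group_commutator G x y |x y. x \<in> lower_central G H j \<and> y \<in> H} \<subseteq>
      {y \<in> carrier G. \<forall>a \<in> lower_central G H i. group_commutator G a y \<in> N}"
      using lower_central_carrier by auto
  qed
  then show ?case
    using Suc.prems by (auto simp: N_def)
qed

text \<open>The shift by \<open>case_nat\<close> undoes the numbering from 0, so that indices add.
  For the new first term \<open>carrier G\<close> the commutator condition is the normality of the
  other terms.\<close>

lemma filtration_lower_central:
  "group_filtration G (case_nat (carrier G) (lower_central G H))"
  unfolding group_filtration_def
proof (intro conjI allI ballI)
  fix i
  show "subgroup (case_nat (carrier G) (lower_central G H) i) G"
    using normal_imp_subgroup[OF normal_lower_central] subgroup_self by (cases i) auto
  show "case_nat (carrier G) (lower_central G H) (Suc i) \<subseteq> case_nat (carrier G) (lower_central G H) i"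
    using lower_central_antimono_Suc lower_central_carrier by (cases i) auto
next
  fix i j x y
  assume "x \<in> case_nat (carrier G) (lower_central G H) i"
    and "y \<in> case_nat (carrier G) (lower_central G H) j"
  then show "group_commutator G x y \<in> case_nat (carrier G) (lower_central G H) (i + j)"
    using commutator_lower_central normal.commutator_mem[OF normal_lower_central] lower_central_carrier
    by (cases i; cases j) (auto simp del: lower_central.simps)
qed

end

section \<open>A zero-one law for commutators on products of cosets\<close>

lemma simple_commutator_cong:
  "(\<And>i. i \<le> k \<Longrightarrow> x i = y i) \<Longrightarrow> simple_commutator G x k = simple_commutator G y k"
  by (induction k) auto

lemma (in group) simple_commutator_closed:
  "(\<And>i. i \<le> k \<Longrightarrow> x i \<in> carrier G) \<Longrightarrow> simple_commutator G x k \<in> carrier G"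
  by (induction k) auto

lemma (in group_hom) hom_simple_commutator:
  "(\<And>i. i \<le> k \<Longrightarrow> x i \<in> carrier G) \<Longrightarrow>
    h (simple_commutator G x k) = simple_commutator H (\<lambda>i. h (x i)) k"
  by (induction k) (simp_all add: hom_group_commutator G.simple_commutator_closed)

context normal
begin

text \<open>This preimage of the centraliser of the image of \<open>H\<close> in \<open>G/N\<close>
  is normal because \<open>H\<close> is. It replaces \<open>N\<close> when the last entry of a
  commutator is integrated out.\<close>

lemma normal_commutators_into:
  assumes "N \<lhd> G"
  shows "{g \<in> carrier G. \<forall>u \<in> H. group_commutator G g u \<in> N} \<lhd> G"
proof -
  interpret N: normal N G by fact
  have "subgroup {g \<in> carrier G. \<forall>u \<in> H. group_commutator G g u \<in> N} G"
    by (rule subgroupI)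
      (auto simp: group_commutator_mult_left group_commutator_inv_left
        intro!: N.m_closed N.inv_op_closed1 N.inv_op_closed2)
  moreover have "group_commutator G (w \<otimes> g \<otimes> inv w) u \<in> N"
    if w: "w \<in> carrier G" and g: "g \<in> carrier G" "\<forall>u \<in> H. group_commutator G g u \<in> N" and u: "u \<in> H"
    for w g u
  proof -
    have "group_commutator G (w \<otimes> g \<otimes> inv w) u =
        w \<otimes> group_commutator G g (inv w \<otimes> u \<otimes> w) \<otimes> inv w"
      using w g u by (simp add: group_commutator_def group_word_simps)
    then show ?thesis
      using g(2) inv_op_closed1[OF w u] w by (simp add: N.inv_op_closed2)
  qed
  ultimately show ?thesis
    unfolding normal_inv_iff by auto
qed

text \<open>If the commutator of the first entries fails to centralise \<open>H\<close> modulo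
  \<open>N\<close>, at least half of the choices of the last entry fail. So replacing
  \<open>N\<close> by the subgroup \<open>N'\<close> of centralising elements, with one entry fewer,
  at most doubles the relative frequency of failure, and the hypothesis survives with one factor 2
  less.\<close>

lemma lower_central_subset:
  assumes fin: "finite H" and N: "N \<lhd> G" and x: "\<And>i. i \<le> k \<Longrightarrow> x i \<in> carrier G"
    and card: "card {h \<in> {..k} \<rightarrow>\<^sub>E H. simple_commutator G (\<lambda>i. x i \<otimes> h i) k \<notin> N} * 2 ^ Suc k
      < card H ^ Suc k"
  shows "lower_central G H k \<subseteq> N"
  using N x card
proof (induction k arbitrary: N)
  case 0
  interpret N: normal N G by fact
  interpret HG: group "G\<lparr>carrier := H\<rparr>" by (rule subgroup_is_group[OF is_group])
  let ?B = "{h \<in> {..0} \<rightarrow>\<^sub>E H. simple_commutator G (\<lambda>i. x i \<otimes> h i) 0 \<notin> N}"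
  have "card {u \<in> H. x 0 \<otimes> u \<notin> N} \<le> card ?B"
  proof (rule card_inj_on_le)
    show "inj_on (\<lambda>u. \<lambda>i \<in> {..0::nat}. u) {u \<in> H. x 0 \<otimes> u \<notin> N}"
      by (rule inj_onI) (metis atMost_iff le_refl restrict_apply')
    show "(\<lambda>u. \<lambda>i \<in> {..0::nat}. u) ` {u \<in> H. x 0 \<otimes> u \<notin> N} \<subseteq> ?B"
      by auto
    show "finite ?B"
      using fin by (simp add: finite_PiE)
  qed
  then have card': "card {u \<in> H. x 0 \<otimes> u \<notin> N} * 2 < card H"
    using 0(3) by simp
  show ?case
  proof
    fix v assume "v \<in> lower_central G H 0"
    then have v: "v \<in> H" by simp
    obtain u where u: "u \<in> H" "x 0 \<otimes> u \<in> N" "x 0 \<otimes> (u \<otimes> v) \<in> N"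
      using HG.exists_mult_right_both[of v "\<lambda>u. x 0 \<otimes> u \<in> N"] fin v card' by auto
    have "inv (x 0 \<otimes> u) \<otimes> (x 0 \<otimes> (u \<otimes> v)) \<in> N"
      using u by blast
    then show "v \<in> N"
      using u v 0(2) by (simp add: group_word_simps)
  qed
next
  case (Suc k)
  interpret N: normal N G by fact
  interpret HG: group "G\<lparr>carrier := H\<rparr>" by (rule subgroup_is_group[OF is_group])
  define N' where "N' = {g \<in> carrier G. \<forall>u \<in> H. group_commutator G g u \<in> N}"
  define c where "c h = simple_commutator G (\<lambda>i. x i \<otimes> h i) k" for h
  define B where "B = {h \<in> {..k} \<rightarrow>\<^sub>E H. c h \<notin> N'}"
  define T where "T h = {u \<in> H. group_commutator G (c h) (x (Suc k) \<otimes> u) \<notin> N}" for h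
  let ?B' = "{h \<in> {..Suc k} \<rightarrow>\<^sub>E H. simple_commutator G (\<lambda>i. x i \<otimes> h i) (Suc k) \<notin> N}"
  have c: "c h \<in> carrier G" if "h \<in> {..k} \<rightarrow>\<^sub>E H" for h
    unfolding c_def using Suc.prems(2) that
    by (intro simple_commutator_closed) (auto simp: PiE_iff)
  have T: "card H \<le> card (T h) * 2" if h: "h \<in> B" for h
  proof (rule ccontr)
    assume less: "\<not> card H \<le> card (T h) * 2"
    have ch: "c h \<in> carrier G" using c h by (auto simp: B_def)
    have "group_commutator G (c h) v \<in> N" if v: "v \<in> H" for v
    proof -
      let ?P = "\<lambda>u. group_commutator G (c h) (x (Suc k) \<otimes> u) \<in> N"
      obtain u where u: "u \<in> H" "?P u" "?P (u \<otimes> v)"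
        using HG.exists_mult_right_both[of v ?P] fin v less by (auto simp: T_def)
      let ?y = "x (Suc k) \<otimes> u"
      have y: "?y \<in> carrier G" using Suc.prems(2)[of "Suc k"] u(1) by simp
      have "group_commutator G (c h) (?y \<otimes> v) \<in> N"
        using u v Suc.prems(2)[of "Suc k"] by (simp add: m_assoc)
      moreover have "inv v \<otimes> group_commutator G (c h) ?y \<otimes> v \<in> N"
        using u(2) v by (simp add: N.inv_op_closed1)
      \<comment> \<open>As \<open>[c, y v]\<close> is \<open>[c, v]\<close> times the conjugate of
        \<open>[c, y]\<close> by \<open>v\<close>, dividing by that conjugate leaves
        \<open>[c, v]\<close>.\<close>
      ultimately have "group_commutator G (c h) (?y \<otimes> v) \<otimes>
          inv (inv v \<otimes> group_commutator G (c h) ?y \<otimes> v) \<in> N"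
        by blast
      then show ?thesis
        using y v ch by (simp add: group_commutator_mult_right m_assoc)
    qed
    then have "c h \<in> N'" using ch by (simp add: N'_def)
    then show False using h by (simp add: B_def)
  qed
  have finB: "finite B" and finT: "finite (T h)" for h
    using fin by (simp_all add: B_def T_def finite_PiE)
  \<comment> \<open>A bad \<open>h\<close> together with a last entry from \<open>T h\<close> is a
    failing tuple with \<open>k + 2\<close> entries.\<close>
  have "card (Sigma B T) \<le> card ?B'"
  proof (rule card_inj_on_le)
    show "inj_on (\<lambda>(h, u). h(Suc k := u)) (Sigma B T)"
    proof (rule inj_onI, clarify)
      fix h u h' u' assume h: "h \<in> B" "h' \<in> B" and eq: "h(Suc k := u) = h'(Suc k := u')"
      have "h i = h' i" for i
        using fun_cong[OF eq, of i] h by (cases "i = Suc k") (auto simp: B_def PiE_def extensional_def)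
      then show "h = h' \<and> u = u'"
        using fun_cong[OF eq, of "Suc k"] by auto
    qed
    show "(\<lambda>(h, u). h(Suc k := u)) ` Sigma B T \<subseteq> ?B'"
    proof clarify
      fix h u assume h: "h \<in> B" and u: "u \<in> T h"
      have "simple_commutator G (\<lambda>i. x i \<otimes> (h(Suc k := u)) i) k = c h"
        unfolding c_def by (rule simple_commutator_cong) simp
      moreover have "h(Suc k := u) \<in> {..Suc k} \<rightarrow>\<^sub>E H"
        using h u by (auto simp: B_def T_def PiE_iff extensional_def le_Suc_eq)
      ultimately show "h(Suc k := u) \<in> {..Suc k} \<rightarrow>\<^sub>E H \<and>
          simple_commutator G (\<lambda>i. x i \<otimes> (h(Suc k := u)) i) (Suc k) \<notin> N"
        using u by (simp add: T_def)
    qed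
    show "finite ?B'"
      using fin by (simp add: finite_PiE)
  qed
  moreover have "card B * card H \<le> (\<Sum>h\<in>B. card (T h) * 2)"
    using sum_mono[of B "\<lambda>_. card H" "\<lambda>h. card (T h) * 2"] T by simp
  moreover have "card (Sigma B T) = (\<Sum>h\<in>B. card (T h))"
    using finB finT by simp
  ultimately have "card B * card H \<le> card ?B' * 2"
    by (simp flip: sum_distrib_right)
  from mult_le_mono1[OF this, of "2 ^ Suc k"]
  have "card B * card H * 2 ^ Suc k \<le> card ?B' * 2 ^ Suc (Suc k)"
    by (simp only: power_Suc mult.assoc)
  also have "\<dots> < card H ^ Suc (Suc k)" by (rule Suc.prems(3))
  finally have "card B * 2 ^ Suc k < card H ^ Suc k"
    by (simp add: mult.commute mult.left_commute)
  then have "lower_central G H k \<subseteq> N'"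
    using Suc.prems(2) normal_commutators_into[OF Suc.prems(1)]
    by (intro Suc.IH) (simp_all add: N'_def B_def c_def)
  then show ?case
    unfolding lower_central.simps
    by (intro generate_subgroup_incl N.subgroup_axioms) (auto simp: N'_def)
qed

text \<open>Each entry is a constant times a coordinate homomorphism on \<open>H^(k + 1)\<close>,
  hence polynomial, and so is the commutator. Nilpotency of \<open>H\<close> makes the filtration
  trivial at \<open>k + 1\<close>, so the law for polynomial maps applies with \<open>k + 1\<close>
  derivatives.\<close>

theorem simple_commutator_zero_one:
  assumes fin: "finite H" and x: "\<And>i. i \<le> k \<Longrightarrow> x i \<in> carrier G"
    and card: "card {h \<in> {..k} \<rightarrow>\<^sub>E H. simple_commutator G (\<lambda>i. x i \<otimes> h i) k \<noteq> \<one>} * 2 ^ Suc k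
      < card H ^ Suc k"
    and h: "h \<in> {..k} \<rightarrow>\<^sub>E H"
  shows "simple_commutator G (\<lambda>i. x i \<otimes> h i) k = \<one>"
proof -
  have triv: "lower_central G H k \<subseteq> {\<one>}"
    using fin x card one_is_normal by (intro lower_central_subset) auto
  define V where "V = product_group {..k} (\<lambda>_. G\<lparr>carrier := H\<rparr>)"
  define F where "F = case_nat (carrier G) (lower_central G H)"
  have carrier_V: "carrier V = {..k} \<rightarrow>\<^sub>E H" by (simp add: V_def)
  have "group V"
    unfolding V_def using subgroup_is_group[OF is_group] by (intro product_group)
  then interpret FM: filtered_maps V G F
    using filtration_lower_central is_group
    by (simp add: filtered_maps_def filtered_group_def filtered_group_axioms_def F_def)
  interpret P: filtered_group FM.maps "polynomial_maps V G F n" for n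
    by (rule FM.polynomial_maps_filtered_group)
  have coord: "(\<lambda>h \<in> carrier V. x i \<otimes> h i) \<in> polynomial_maps V G F n 0" if i: "i \<le> k" for i n
  proof -
    have "(\<lambda>h. h i) \<in> hom V G"
      using i by (auto simp: V_def hom_def PiE_iff)
    moreover have "(\<lambda>h. h i) ` carrier V \<subseteq> F 1"
      using i by (auto simp: carrier_V F_def)
    ultimately have "(\<lambda>h \<in> carrier V. h i) \<in> polynomial_maps V G F n 0"
      by (rule FM.polynomial_maps_hom)
    \<comment> \<open>The constant \<open>x i\<close> is only known to lie in \<open>F 0\<close>,
      while the coordinate takes values in \<open>F 1 = H\<close>. This is why the filtration begins
      with the whole group.\<close>
    moreover have "(\<lambda>h \<in> carrier V. x i) \<in> polynomial_maps V G F n 0"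
      using x[OF i] by (intro FM.polynomial_maps_const) (simp add: F_def)
    ultimately have "(\<lambda>h \<in> carrier V. x i) \<otimes>\<^bsub>FM.maps\<^esub> (\<lambda>h \<in> carrier V. h i) \<in> polynomial_maps V G F n 0"
      by (intro P.F_mult)
    moreover have "(\<lambda>h \<in> carrier V. x i) \<otimes>\<^bsub>FM.maps\<^esub> (\<lambda>h \<in> carrier V. h i) =
        (\<lambda>h \<in> carrier V. x i \<otimes> h i)"
      by (auto intro!: restrict_ext)
    ultimately show ?thesis by simp
  qed
  have poly: "(\<lambda>h \<in> carrier V. simple_commutator G (\<lambda>i. x i \<otimes> h i) j) \<in> polynomial_maps V G F n 0"
    if "j \<le> k" for j n
    using that
  proof (induction j)
    case 0
    then show ?case using coord[of 0] by (simp del: restrict_apply)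
  next
    case (Suc j)
    let ?f = "\<lambda>h \<in> carrier V. simple_commutator G (\<lambda>i. x i \<otimes> h i) j"
    let ?g = "\<lambda>h \<in> carrier V. x (Suc j) \<otimes> h (Suc j)"
    have f: "?f \<in> polynomial_maps V G F n 0" and g: "?g \<in> polynomial_maps V G F n 0"
      using Suc coord[of "Suc j"] by (simp_all del: restrict_apply)
    have "group_commutator FM.maps ?f ?g \<in> polynomial_maps V G F n 0"
      using P.F_commutator[OF f g] by simp
    moreover have "group_commutator FM.maps ?f ?g =
        (\<lambda>h \<in> carrier V. simple_commutator G (\<lambda>i. x i \<otimes> h i) (Suc j))"
      by (subst FM.commutator_maps[OF P.F_closed[OF f] P.F_closed[OF g]]) (auto intro!: restrict_ext)
    ultimately show ?case by (simp only:)
  qed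
  let ?c = "\<lambda>h \<in> carrier V. simple_commutator G (\<lambda>i. x i \<otimes> h i) k"
  have F_top: "F (0 + Suc k) = {\<one>}"
    using triv subgroup.one_closed[OF FM.subgroup_F, of "Suc k"] by (auto simp: F_def)
  have finV: "finite (carrier V)" and cardV: "card (carrier V) = card H ^ Suc k"
    using fin by (simp_all add: carrier_V finite_PiE card_PiE)
  have "{h \<in> carrier V. ?c h \<notin> F (0 + Suc k)} =
      {h \<in> {..k} \<rightarrow>\<^sub>E H. simple_commutator G (\<lambda>i. x i \<otimes> h i) k \<noteq> \<one>}"
    unfolding F_top carrier_V by auto
  then have "?c h \<in> F (0 + Suc k)"
    using card h finV cardV
    by (intro FM.polynomial_maps_zero_one[OF finV poly]) (simp_all add: carrier_V)
  then show ?thesis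
    using h unfolding F_top carrier_V by simp
qed

section \<open>Commutators modulo a normal subgroup\<close>

lemma rcos_eq_self_iff: "x \<in> carrier G \<Longrightarrow> H #> x = H \<longleftrightarrow> x \<in> H"
  using coset_join1[OF _ _ subgroup_axioms] coset_join2[OF _ subgroup_axioms] by metis

lemma rcos_mult_mem:
  assumes "x \<in> carrier G" "h \<in> H"
  shows "H #> (x \<otimes> h) = H #> x"
proof -
  have "x \<otimes> h = (x \<otimes> h \<otimes> inv x) \<otimes> x"
    using assms by (simp add: m_assoc)
  then have "H #> (x \<otimes> h) = (H #> (x \<otimes> h \<otimes> inv x)) #> x"
    using assms subset by (simp add: coset_mult_assoc)
  also have "H #> (x \<otimes> h \<otimes> inv x) = H"
    using assms inv_op_closed2[OF assms] by (simp add: rcos_eq_self_iff)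
  finally show ?thesis .
qed

lemma group_hom_Mod: "group_hom G (G Mod H) (\<lambda>x. H #> x)"
  using is_group factorgroup_is_group r_coset_hom_Mod
  by (simp add: group_hom_def group_hom_axioms_def)

lemma simple_commutator_mem_iff:
  assumes "\<And>i. i \<le> k \<Longrightarrow> x i \<in> carrier G"
  shows "simple_commutator G x k \<in> H \<longleftrightarrow> simple_commutator (G Mod H) (\<lambda>i. H #> x i) k = H"
proof -
  have "H #> simple_commutator G x k = simple_commutator (G Mod H) (\<lambda>i. H #> x i) k"
    by (rule group_hom.hom_simple_commutator[OF group_hom_Mod]) (rule assms)
  moreover have "simple_commutator G x k \<in> carrier G"
    by (rule simple_commutator_closed) (rule assms)
  ultimately show ?thesis
    by (simp flip: rcos_eq_self_iff)
qed

lemma simple_commutator_mem_shift: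
  assumes "\<And>i. i \<le> k \<Longrightarrow> x i \<in> carrier G" "\<And>i. i \<le> k \<Longrightarrow> h i \<in> H"
  shows "simple_commutator G (\<lambda>i. x i \<otimes> h i) k \<in> H \<longleftrightarrow> simple_commutator G x k \<in> H"
proof -
  have "simple_commutator (G Mod H) (\<lambda>i. H #> (x i \<otimes> h i)) k =
      simple_commutator (G Mod H) (\<lambda>i. H #> x i) k"
    using assms by (intro simple_commutator_cong rcos_mult_mem) auto
  then show ?thesis
    using assms by (subst (1 2) simple_commutator_mem_iff) auto
qed

text \<open>With \<open>?D \<subseteq> ?E \<subseteq> ?A\<close> this says
  \<open>card ?A - card ?D \<le> 2 ^ Suc k * (card ?A - card ?E)\<close>, written without
  subtraction on naturals. On each product coset inside \<open>?A\<close> but outside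
  \<open>?D\<close>, the zero-one law makes the commutator nontrivial with relative frequency at
  least \<open>1 / 2 ^ Suc k\<close>.\<close>

theorem card_simple_commutator_trivial:
  assumes fin: "finite (carrier G)"
  shows "card {x \<in> {..k} \<rightarrow>\<^sub>E carrier G. simple_commutator G x k = \<one>} * 2 ^ Suc k +
      card {x \<in> {..k} \<rightarrow>\<^sub>E carrier G. simple_commutator G x k \<in> H} \<le>
    card {x \<in> {..k} \<rightarrow>\<^sub>E carrier G. simple_commutator G x k \<in> H} * 2 ^ Suc k +
      card {x \<in> {..k} \<rightarrow>\<^sub>E carrier G.
        \<forall>h \<in> {..k} \<rightarrow>\<^sub>E H. simple_commutator G (\<lambda>i. x i \<otimes> h i) k = \<one>}"
    (is "card ?E * _ + card ?A \<le> card ?A * _ + card ?D")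
proof -
  define W where "W = ({..k} \<rightarrow>\<^sub>E carrier G)"
  define U where "U = ({..k} \<rightarrow>\<^sub>E H)"
  define s where "s = (2 :: nat) ^ Suc k"
  define N where "N x = card {h \<in> U. simple_commutator G (\<lambda>i. x i \<otimes> h i) k = \<one>}" for x
  have finH: "finite H" using fin subset finite_subset by blast
  have finW: "finite W" and finU: "finite U"
    using fin finH by (simp_all add: W_def U_def finite_PiE)
  have UW: "U \<subseteq> W" using subset by (auto simp: U_def W_def PiE_iff)
  have one: "(\<lambda>i \<in> {..k}. \<one>) \<in> U" by (auto simp: U_def)
  then have posU: "card U > 0" using finU by (auto simp: card_gt_0_iff)
  have cardU: "card U = card H ^ Suc k" by (simp add: U_def card_PiE)
  interpret PG: group "product_group {..k} (\<lambda>_. G)"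
    using is_group by simp
  define A where "A = ?A"
  define D where "D = ?D"
  \<comment> \<open>\<open>N x\<close> counts the solutions in the product coset of
    \<open>x\<close>, and summing over \<open>x\<close> gives the claim multiplied by
    \<open>card U\<close>. A product coset lies in \<open>A\<close> entirely or not at all; only the
    third case below needs the zero-one law.\<close>
  have pointwise: "N x * s + card U * of_bool (x \<in> A) \<le> card U * s * of_bool (x \<in> A) + card U * of_bool (x \<in> D)"
    if x: "x \<in> W" for x
  proof -
    have xi: "x i \<in> carrier G" if "i \<le> k" for i
      using x that by (auto simp: W_def)
    have mem: "simple_commutator G (\<lambda>i. x i \<otimes> h i) k \<in> H \<longleftrightarrow> simple_commutator G x k \<in> H"
      if "h \<in> U" for h
      using that xi by (intro simple_commutator_mem_shift) (auto simp: U_def)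
    have A: "x \<in> A \<longleftrightarrow> simple_commutator G x k \<in> H"
      and D: "x \<in> D \<longleftrightarrow> (\<forall>h \<in> U. simple_commutator G (\<lambda>i. x i \<otimes> h i) k = \<one>)"
      using x by (auto simp: A_def D_def W_def U_def)
    have NU: "N x \<le> card U"
      unfolding N_def using finU by (intro card_mono) auto
    have DA: "x \<in> A" if "x \<in> D"
    proof -
      have "simple_commutator G (\<lambda>i. x i \<otimes> (\<lambda>i \<in> {..k}. \<one>) i) k = \<one>"
        using that one by (simp add: D del: restrict_apply)
      then show ?thesis
        using mem[OF one] one_closed by (simp add: A del: restrict_apply)
    qed
    consider "x \<notin> A" "x \<notin> D" | "x \<in> A" "x \<in> D" | "x \<in> A" "x \<notin> D"
      using DA by blast
    then show ?thesis
    proof cases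
      case 1
      then have "simple_commutator G x k \<notin> H" by (simp add: A)
      then have "{h \<in> U. simple_commutator G (\<lambda>i. x i \<otimes> h i) k = \<one>} = {}"
        using mem one_closed by force
      then have "N x = 0" unfolding N_def by (simp only: card.empty)
      then show ?thesis using 1 by simp
    next
      case 2
      then show ?thesis using NU by simp
    next
      case 3
      then obtain h where h: "h \<in> U" "simple_commutator G (\<lambda>i. x i \<otimes> h i) k \<noteq> \<one>"
        by (auto simp: D)
      let ?bad = "{h \<in> U. simple_commutator G (\<lambda>i. x i \<otimes> h i) k \<noteq> \<one>}"
      have "\<not> card ?bad * s < card U"
        using simple_commutator_zero_one[OF finH, of k x h] xi h unfolding U_def s_def cardU[unfolded U_def]
        by auto
      moreover have "card ?bad = card U - N x"
      proof -
        have "?bad = U - {h \<in> U. simple_commutator G (\<lambda>i. x i \<otimes> h i) k = \<one>}" by auto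
        then show ?thesis using finU by (simp add: card_Diff_subset N_def)
      qed
      ultimately have "card U \<le> (card U - N x) * s" by simp
      then have "N x * s + card U \<le> card U * s"
        using mult_le_mono1[OF NU, of s] unfolding diff_mult_distrib by linarith
      then show ?thesis using 3 by simp
    qed
  qed
  \<comment> \<open>Double counting: for fixed \<open>h\<close>, multiplication by \<open>h\<close>
    permutes all tuples, so every \<open>h\<close> contributes \<open>card ?E\<close>.\<close>
  have "(\<Sum>x\<in>W. N x) = (\<Sum>x\<in>W. \<Sum>h\<in>U. of_bool (simple_commutator G (\<lambda>i. x i \<otimes> h i) k = \<one>))"
    using finU by (simp add: N_def Int_def)
  also have "\<dots> = (\<Sum>h\<in>U. \<Sum>x\<in>W. of_bool (simple_commutator G (\<lambda>i. x i \<otimes> h i) k = \<one>))"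
    by (rule sum.swap)
  also have "\<dots> = (\<Sum>h\<in>U. card {x \<in> W. simple_commutator G (\<lambda>i. x i \<otimes> h i) k = \<one>})"
    using finW by (simp add: Int_def)
  also have "\<dots> = (\<Sum>h\<in>U. card ?E)"
  proof (rule sum.cong)
    fix h assume "h \<in> U"
    then have "h \<in> carrier (product_group {..k} (\<lambda>_. G))"
      using UW by (auto simp: W_def)
    from PG.card_mult_right[OF this, of "\<lambda>x. simple_commutator G x k = \<one>"]
    have "card {x \<in> W. simple_commutator G (\<lambda>i\<in>{..k}. x i \<otimes> h i) k = \<one>} = card ?E"
      by (simp add: W_def)
    moreover have "simple_commutator G (\<lambda>i\<in>{..k}. x i \<otimes> h i) k = simple_commutator G (\<lambda>i. x i \<otimes> h i) k" for x
      by (rule simple_commutator_cong) simp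
    ultimately show "card {x \<in> W. simple_commutator G (\<lambda>i. x i \<otimes> h i) k = \<one>} = card ?E"
      by simp
  qed simp
  finally have sumN: "(\<Sum>x\<in>W. N x) = card U * card ?E" by simp
  have "(\<Sum>x\<in>W. N x * s + card U * of_bool (x \<in> A)) \<le>
      (\<Sum>x\<in>W. card U * s * of_bool (x \<in> A) + card U * of_bool (x \<in> D))"
    by (rule sum_mono) (rule pointwise)
  moreover have "(\<Sum>x\<in>W. of_bool (x \<in> A)) = card A" "(\<Sum>x\<in>W. of_bool (x \<in> D)) = card D"
    using finW by (simp_all add: A_def D_def W_def Int_def)
  ultimately have "card U * (card ?E * s + card A) \<le> card U * (card A * s + card D)"
    using sumN by (simp add: sum.distrib algebra_simps flip: sum_distrib_left sum_distrib_right)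
  then show ?thesis
    using posU by (simp add: s_def A_def D_def)
qed

end

section \<open>Measures of unions of cosets\<close>

text \<open>Independence gives the measure of a box, and finite additivity that of the union. Events
  decided modulo a finite-index normal subgroup are such unions.\<close>

lemma measure_PiM_UN_PiE:
  fixes M :: "'a measure" and B :: "('i \<Rightarrow> 'a set) set"
  assumes M: "prob_space M" and I: "finite I" and B: "finite B"
    and sets: "\<And>X i. X \<in> B \<Longrightarrow> i \<in> I \<Longrightarrow> X i \<in> sets M"
    and disj: "disjoint_family_on (\<lambda>X. Pi\<^sub>E I X) B"
  shows "(\<Union>X\<in>B. Pi\<^sub>E I X) \<in> sets (Pi\<^sub>M I (\<lambda>_. M))"
    and "measure (Pi\<^sub>M I (\<lambda>_. M)) (\<Union>X\<in>B. Pi\<^sub>E I X) = (\<Sum>X\<in>B. \<Prod>i\<in>I. measure M (X i))"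
proof -
  interpret M: prob_space M by fact
  interpret P: finite_product_prob_space "\<lambda>_. M" I
    by unfold_locales (rule I)
  have PiE: "Pi\<^sub>E I X \<in> sets (Pi\<^sub>M I (\<lambda>_. M))" if "X \<in> B" for X
    using sets[OF that] I by (intro sets_PiM_I_finite) auto
  then show "(\<Union>X\<in>B. Pi\<^sub>E I X) \<in> sets (Pi\<^sub>M I (\<lambda>_. M))"
    using B by blast
  have "measure (Pi\<^sub>M I (\<lambda>_. M)) (\<Union>X\<in>B. Pi\<^sub>E I X) = (\<Sum>X\<in>B. measure (Pi\<^sub>M I (\<lambda>_. M)) (Pi\<^sub>E I X))"
    using B PiE disj by (intro P.finite_measure_finite_Union) auto
  also have "\<dots> = (\<Sum>X\<in>B. \<Prod>i\<in>I. measure M (X i))"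
    using sets by (intro sum.cong refl P.prob_times) auto
  finally show "measure (Pi\<^sub>M I (\<lambda>_. M)) (\<Union>X\<in>B. Pi\<^sub>E I X) = (\<Sum>X\<in>B. \<Prod>i\<in>I. measure M (X i))" .
qed

lemma (in group) dc_finite_eq_card:
  assumes fin: "finite (carrier G)"
  shows "dc_finite k G =
    card {x \<in> {..k} \<rightarrow>\<^sub>E carrier G. simple_commutator G x k = \<one>} / card (carrier G) ^ Suc k"
proof -
  let ?\<mu> = "uniform_count_measure (carrier G)"
  let ?E = "{x \<in> {..k} \<rightarrow>\<^sub>E carrier G. simple_commutator G x k = \<one>}"
  let ?s = "\<lambda>(x :: nat \<Rightarrow> 'a) i. {x i}"
  have ne: "carrier G \<noteq> {}" using one_closed by blast
  have finE: "finite ?E" using fin by (simp add: finite_PiE)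
  have PiE_sing: "Pi\<^sub>E {..k} (?s x) = {x}" if "x \<in> ?E" for x
    using that by (intro PiE_singleton) (auto simp: PiE_def)
  have inj: "inj_on ?s ?E"
    by (rule inj_onI) (metis ext singleton_inject)
  have "?E = (\<Union>X\<in>?s ` ?E. Pi\<^sub>E {..k} X)"
    using PiE_sing by auto
  moreover have "disjoint_family_on (Pi\<^sub>E {..k}) (?s ` ?E)"
    using PiE_sing by (auto simp: disjoint_family_on_def)
  then have "measure (Pi\<^sub>M {..k} (\<lambda>_. ?\<mu>)) (\<Union>X\<in>?s ` ?E. Pi\<^sub>E {..k} X) =
      (\<Sum>X\<in>?s ` ?E. \<Prod>i\<in>{..k}. measure ?\<mu> (X i))"
    using fin ne finE prob_space_uniform_count_measure
    by (intro measure_PiM_UN_PiE) (auto simp: sets_uniform_count_measure)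
  moreover have "(\<Sum>X\<in>?s ` ?E. \<Prod>i\<in>{..k}. measure ?\<mu> (X i)) = (\<Sum>x\<in>?E. \<Prod>i\<in>{..k}. measure ?\<mu> {x i})"
    using inj by (simp add: sum.reindex)
  moreover have "\<dots> = (\<Sum>x\<in>?E. (1 / card (carrier G)) ^ Suc k)"
  proof (rule sum.cong[OF refl])
    fix x assume x: "x \<in> ?E"
    have "(\<Prod>i\<in>{..k}. measure ?\<mu> {x i}) = (\<Prod>i\<in>{..k}. 1 / card (carrier G))"
      using x fin by (intro prod.cong refl) (auto simp: measure_uniform_count_measure PiE_iff)
    then show "(\<Prod>i\<in>{..k}. measure ?\<mu> {x i}) = (1 / card (carrier G)) ^ Suc k" by simp
  qed
  ultimately have "measure (Pi\<^sub>M {..k} (\<lambda>_. ?\<mu>)) ?E = card ?E / card (carrier G) ^ Suc k"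
    by (simp add: power_divide)
  then show ?thesis
    by (simp add: dc_finite_def dc_measure_def space_PiM space_uniform_count_measure)
qed

text \<open>The pullback of \<open>B\<close> along the projection of \<open>G^(k + 1)\<close> to
  \<open>(G/N)^(k + 1)\<close>.\<close>

definition coset_preimage ::
    "('a, 'b) monoid_scheme \<Rightarrow> 'a set \<Rightarrow> nat \<Rightarrow> (nat \<Rightarrow> 'a set) set \<Rightarrow> (nat \<Rightarrow> 'a) set" where
  "coset_preimage G N k B =
    {x \<in> {..k} \<rightarrow>\<^sub>E carrier G. (\<lambda>i \<in> {..k}. N #>\<^bsub>G\<^esub> x i) \<in> B}"

section \<open>Probabilities of events decided by cosets\<close>

context normal
begin

text \<open>A point \<open>X\<close> of \<open>(G/H)^(k + 1)\<close> is itself a tuple of subsets of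
  \<open>G\<close>, and the box \<open>Pi\<^sub>E {..k} X\<close> is the fibre over it.\<close>

lemma coset_preimage_eq_UN:
  assumes "B \<subseteq> ({..k} \<rightarrow>\<^sub>E carrier (G Mod H))"
  shows "coset_preimage G H k B = (\<Union>X\<in>B. Pi\<^sub>E {..k} X)"
proof (intro equalityI subsetI)
  fix x assume x: "x \<in> coset_preimage G H k B"
  then have "x \<in> Pi\<^sub>E {..k} (\<lambda>i \<in> {..k}. H #> x i)"
    using rcos_self[OF _ subgroup_axioms] by (auto simp: coset_preimage_def PiE_iff)
  then show "x \<in> (\<Union>X\<in>B. Pi\<^sub>E {..k} X)"
    using x by (auto simp: coset_preimage_def simp del: restrict_apply)
next
  fix x assume "x \<in> (\<Union>X\<in>B. Pi\<^sub>E {..k} X)"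
  then obtain X where X: "X \<in> B" "x \<in> Pi\<^sub>E {..k} X" by blast
  have XQ: "X \<in> {..k} \<rightarrow>\<^sub>E carrier (G Mod H)" using X assms by blast
  have *: "x i \<in> carrier G \<and> H #> x i = X i" if i: "i \<le> k" for i
  proof -
    have "X i \<in> carrier (G Mod H)" using XQ i by auto
    then obtain g where g: "g \<in> carrier G" "X i = H #> g" by (auto simp: carrier_FactGroup)
    have xi: "x i \<in> H #> g" using X i g by auto
    then show ?thesis
      using repr_independence[OF xi g(1) subgroup_axioms] g r_coset_subset_G[OF subset g(1)] by auto
  qed
  then have "(\<lambda>i \<in> {..k}. H #> x i) = X"
    using XQ by (intro ext) (auto simp: PiE_iff extensional_def)
  then show "x \<in> coset_preimage G H k B"
    using X * by (auto simp: coset_preimage_def PiE_iff)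
qed

lemma disjoint_family_PiE_cosets:
  fixes k :: nat
  assumes "B \<subseteq> ({..k} \<rightarrow>\<^sub>E carrier (G Mod H))"
  shows "disjoint_family_on (Pi\<^sub>E {..k}) B"
proof -
  have "X = Y" if "X \<in> B" "Y \<in> B" "x \<in> Pi\<^sub>E {..k} X" "x \<in> Pi\<^sub>E {..k} Y" for X Y x
  proof -
    have "x \<in> coset_preimage G H k {X}" "x \<in> coset_preimage G H k {Y}"
      using that assms by (auto simp: coset_preimage_eq_UN)
    then show ?thesis by (simp add: coset_preimage_def)
  qed
  then show ?thesis by (auto simp: disjoint_family_on_def)
qed

lemma finite_carrier_Mod: "finite_index G H \<Longrightarrow> finite (carrier (G Mod H))"
  by (simp add: finite_index_def FactGroup_def)

lemma coset_preimage_sets: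
  assumes \<mu>: "prob_measure_on G \<mu>" and fin: "finite_index G H"
    and B: "B \<subseteq> ({..k} \<rightarrow>\<^sub>E carrier (G Mod H))"
  shows "coset_preimage G H k B \<in> sets (Pi\<^sub>M {..k} (\<lambda>_. \<mu>))"
    and "measure (Pi\<^sub>M {..k} (\<lambda>_. \<mu>)) (coset_preimage G H k B) =
      (\<Sum>X\<in>B. \<Prod>i\<in>{..k}. measure \<mu> (X i))"
proof -
  have finB: "finite B"
    using B finite_carrier_Mod[OF fin] finite_subset by (fastforce intro: finite_PiE)
  have X: "X i \<in> sets \<mu>" if "X \<in> B" "i \<in> {..k}" for X i
  proof -
    have "X i \<in> carrier (G Mod H)" using that B by auto
    then obtain g where "g \<in> carrier G" "X i = H #> g" by (auto simp: carrier_FactGroup)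
    then show ?thesis
      using \<mu> r_coset_subset_G[OF subset] by (auto simp: prob_measure_on_def)
  qed
  have prob: "prob_space \<mu>" using \<mu> by (simp add: prob_measure_on_def)
  note disj = disjoint_family_PiE_cosets[OF B]
  show "coset_preimage G H k B \<in> sets (Pi\<^sub>M {..k} (\<lambda>_. \<mu>))"
    unfolding coset_preimage_eq_UN[OF B]
    by (rule measure_PiM_UN_PiE(1)[OF prob finite_atMost finB _ disj]) (rule X)
  show "measure (Pi\<^sub>M {..k} (\<lambda>_. \<mu>)) (coset_preimage G H k B) =
      (\<Sum>X\<in>B. \<Prod>i\<in>{..k}. measure \<mu> (X i))"
    unfolding coset_preimage_eq_UN[OF B]
    by (rule measure_PiM_UN_PiE(2)[OF prob finite_atMost finB _ disj]) (rule X)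
qed

text \<open>The measure is a finite sum of products of \<open>k + 1\<close> coset measures, each of
  which tends to the inverse index.\<close>

lemma tendsto_measure_coset_preimage:
  assumes M: "\<And>n. prob_measure_on G (M n)" and idx: "measures_index_uniformly G M"
    and fin: "finite_index G H" and B: "B \<subseteq> ({..k} \<rightarrow>\<^sub>E carrier (G Mod H))"
  shows "(\<lambda>n. measure (Pi\<^sub>M {..k} (\<lambda>_. M n)) (coset_preimage G H k B)) \<longlonglongrightarrow>
    card B / card (carrier (G Mod H)) ^ Suc k"
proof -
  have "(\<lambda>n. measure (M n) (X i)) \<longlonglongrightarrow> 1 / card (carrier (G Mod H))"
    if "X \<in> B" "i \<in> {..k}" for X i
  proof -
    have "X i \<in> carrier (G Mod H)" using that B by auto
    \<comment> \<open>Elements of the factor group are right cosets, whereas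
      \<open>measures_index_uniformly\<close> speaks of left cosets; they agree by
      normality.\<close>
    then obtain g where g: "g \<in> carrier G" "X i = g <# H"
      using coset_eq by (auto simp: carrier_FactGroup)
    have "(\<lambda>n. (\<lambda>(x, K). measure (M n) (x <# K)) (g, H)) \<longlonglongrightarrow> (\<lambda>(x, K). inverse_index G K) (g, H)"
      by (rule tendsto_uniform_limitI[OF idx[unfolded measures_index_uniformly_def]])
        (use g subgroup_axioms in auto)
    then show ?thesis
      using fin g by (simp add: inverse_index_def FactGroup_def)
  qed
  then have "(\<lambda>n. \<Sum>X\<in>B. \<Prod>i\<in>{..k}. measure (M n) (X i)) \<longlonglongrightarrow>
      (\<Sum>X\<in>B. \<Prod>i\<in>{..k}. 1 / card (carrier (G Mod H)))"
    by (intro tendsto_sum tendsto_prod)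
  then show ?thesis
    by (simp add: coset_preimage_sets(2)[OF M fin B] power_divide)
qed

end

text \<open>First fix \<open>m\<close> so that \<open>p m\<close>, respectively
  \<open>p m - c * (p m - \<alpha>)\<close>, is close to \<open>\<alpha>\<close>; the bounds for
  this \<open>m\<close> then hold for all large \<open>n\<close>.\<close>

lemma decseq_tendsto_unique_between:
  fixes D :: "nat \<Rightarrow> real" and p d :: "nat \<Rightarrow> real"
  assumes p: "p \<longlonglongrightarrow> \<alpha>" and c: "c \<ge> 0"
    and upper: "\<And>m e. e > 0 \<Longrightarrow> \<forall>\<^sub>F n in sequentially. D n < p m + e"
    and lower: "\<And>m e. e > 0 \<Longrightarrow> \<forall>\<^sub>F n in sequentially. D n > d m - e"
    and d: "\<And>m. d m \<ge> p m - c * (p m - \<alpha>)"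
  shows "D \<longlonglongrightarrow> \<alpha>"
proof (rule order_tendstoI)
  fix a assume a: "a < \<alpha>"
  have "(\<lambda>m. p m - c * (p m - \<alpha>)) \<longlonglongrightarrow> \<alpha> - c * (\<alpha> - \<alpha>)"
    by (intro tendsto_intros p)
  then have "(\<lambda>m. p m - c * (p m - \<alpha>)) \<longlonglongrightarrow> \<alpha>" by simp
  then have "\<forall>\<^sub>F m in sequentially. p m - c * (p m - \<alpha>) > a"
    using a by (rule order_tendstoD)
  then obtain m where "p m - c * (p m - \<alpha>) > a"
    by (meson eventually_sequentially order_refl)
  then have "d m - a > 0" using d[of m] by simp
  then show "\<forall>\<^sub>F n in sequentially. a < D n"
    using lower[of "d m - a" m] by simp
next
  fix a assume a: "\<alpha> < a"
  have "\<forall>\<^sub>F m in sequentially. p m < a"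
    using p a by (rule order_tendstoD)
  then obtain m where "p m < a"
    by (meson eventually_sequentially order_refl)
  then show "\<forall>\<^sub>F n in sequentially. D n < a"
    using upper[of "a - p m" m] by simp
qed

context normal
begin

text \<open>The counterpart of the set \<open>?D\<close> in
  \<open>card_simple_commutator_trivial\<close>, with the commutator trivial in \<open>G\<close>
  itself and not only modulo a smaller subgroup.\<close>

definition trivial_on_cosets :: "nat \<Rightarrow> (nat \<Rightarrow> 'a) set" where
  "trivial_on_cosets k = {x \<in> {..k} \<rightarrow>\<^sub>E carrier G.
    \<forall>h \<in> {..k} \<rightarrow>\<^sub>E H. simple_commutator G (\<lambda>i. x i \<otimes> h i) k = \<one>}"

lemma coset_preimage_commutator:
  "coset_preimage G H k {X \<in> {..k} \<rightarrow>\<^sub>E carrier (G Mod H). simple_commutator (G Mod H) X k = H} =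
    {x \<in> {..k} \<rightarrow>\<^sub>E carrier G. simple_commutator G x k \<in> H}"
proof -
  have "simple_commutator (G Mod H) (\<lambda>i \<in> {..k}. H #> x i) k = H \<longleftrightarrow> simple_commutator G x k \<in> H"
    and "(\<lambda>i \<in> {..k}. H #> x i) \<in> {..k} \<rightarrow>\<^sub>E carrier (G Mod H)"
    if x: "x \<in> {..k} \<rightarrow>\<^sub>E carrier G" for x
  proof -
    have xi: "x i \<in> carrier G" if "i \<le> k" for i using x that by auto
    have "simple_commutator (G Mod H) (\<lambda>i \<in> {..k}. H #> x i) k =
        simple_commutator (G Mod H) (\<lambda>i. H #> x i) k"
      by (rule simple_commutator_cong) simp
    then show "simple_commutator (G Mod H) (\<lambda>i \<in> {..k}. H #> x i) k = H \<longleftrightarrow> simple_commutator G x k \<in> H"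
      by (simp add: simple_commutator_mem_iff[OF xi])
    show "(\<lambda>i \<in> {..k}. H #> x i) \<in> {..k} \<rightarrow>\<^sub>E carrier (G Mod H)"
      using xi by (auto simp: carrier_FactGroup)
  qed
  then show ?thesis
    by (auto simp: coset_preimage_def simp del: restrict_apply)
qed

lemma dc_finite_Mod:
  assumes fin: "finite_index G H"
  shows "dc_finite k (G Mod H) =
    card {X \<in> {..k} \<rightarrow>\<^sub>E carrier (G Mod H). simple_commutator (G Mod H) X k = H} /
      card (carrier (G Mod H)) ^ Suc k"
  using group.dc_finite_eq_card[OF factorgroup_is_group finite_carrier_Mod[OF fin]] by simp

lemma commutator_event_sets:
  assumes "prob_measure_on G \<mu>" "finite_index G H"
  shows "{x \<in> {..k} \<rightarrow>\<^sub>E carrier G. simple_commutator G x k \<in> H} \<in> sets (Pi\<^sub>M {..k} (\<lambda>_. \<mu>))"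
  unfolding coset_preimage_commutator[symmetric]
  by (rule coset_preimage_sets(1)[OF assms]) auto

lemma tendsto_dc_finite_Mod:
  assumes "\<And>n. prob_measure_on G (M n)" "measures_index_uniformly G M" "finite_index G H"
  shows "(\<lambda>n. measure (Pi\<^sub>M {..k} (\<lambda>_. M n))
    {x \<in> {..k} \<rightarrow>\<^sub>E carrier G. simple_commutator G x k \<in> H}) \<longlonglongrightarrow> dc_finite k (G Mod H)"
  unfolding coset_preimage_commutator[symmetric] dc_finite_Mod[OF assms(3)]
  by (rule tendsto_measure_coset_preimage[OF assms]) auto

lemma mem_PiE_cosets_iff:
  assumes x: "x \<in> {..k} \<rightarrow>\<^sub>E carrier G"
  shows "y \<in> Pi\<^sub>E {..k} (\<lambda>i. H #> x i) \<longleftrightarrow>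
    (\<exists>h \<in> {..k} \<rightarrow>\<^sub>E H. y = (\<lambda>i \<in> {..k}. x i \<otimes> h i))"
proof
  assume y: "y \<in> Pi\<^sub>E {..k} (\<lambda>i. H #> x i)"
  have "\<exists>h \<in> H. y i = x i \<otimes> h" if "i \<le> k" for i
  proof -
    have "y i \<in> x i <# H"
      using y x that coset_eq by (auto simp: PiE_iff)
    then show ?thesis by (auto simp: l_coset_def)
  qed
  then obtain h where h: "\<And>i. i \<le> k \<Longrightarrow> h i \<in> H" "\<And>i. i \<le> k \<Longrightarrow> y i = x i \<otimes> h i"
    by metis
  show "\<exists>h \<in> {..k} \<rightarrow>\<^sub>E H. y = (\<lambda>i \<in> {..k}. x i \<otimes> h i)"
  proof
    show "restrict h {..k} \<in> {..k} \<rightarrow>\<^sub>E H" using h by auto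
    show "y = (\<lambda>i \<in> {..k}. x i \<otimes> restrict h {..k} i)"
      using h y by (auto simp: fun_eq_iff PiE_iff extensional_def)
  qed
next
  assume "\<exists>h \<in> {..k} \<rightarrow>\<^sub>E H. y = (\<lambda>i \<in> {..k}. x i \<otimes> h i)"
  then obtain h where h: "h \<in> {..k} \<rightarrow>\<^sub>E H" and y: "y = (\<lambda>i \<in> {..k}. x i \<otimes> h i)" by blast
  have "x i \<otimes> h i \<in> H #> x i" if "i \<le> k" for i
  proof -
    have "x i \<in> carrier G" "h i \<in> H" using x h that by auto
    moreover from this have "x i \<otimes> h i \<in> x i <# H" by (auto simp: l_coset_def)
    ultimately show ?thesis using coset_eq by auto
  qed
  then show "y \<in> Pi\<^sub>E {..k} (\<lambda>i. H #> x i)" by (simp add: y)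
qed

text \<open>The counting theorem is applied to the finite group \<open>G/N\<close> with normal
  subgroup \<open>H/N\<close> and divided by the number of tuples. The set \<open>A\<close> pulls
  back to the event that the commutator lies in \<open>H\<close>, and by \<open>stable\<close> the
  set \<open>D\<close> pulls back to \<open>trivial_on_cosets k\<close>; the limit \<open>d\<close>
  is the density of \<open>D\<close>.\<close>

lemma density_lower_bound:
  assumes N: "N \<lhd> G" and fin: "finite_index G N" and NH: "N \<subseteq> H" and finH: "finite_index G H"
    and M: "\<And>n. prob_measure_on G (M n)" and idx: "measures_index_uniformly G M"
    and stable: "\<And>x. x \<in> {..k} \<rightarrow>\<^sub>E carrier G \<Longrightarrow>
      (\<And>h. h \<in> {..k} \<rightarrow>\<^sub>E H \<Longrightarrow> simple_commutator G (\<lambda>i. x i \<otimes> h i) k \<in> N) \<Longrightarrow>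
      x \<in> trivial_on_cosets k"
  obtains d where "(\<lambda>n. measure (Pi\<^sub>M {..k} (\<lambda>_. M n)) (trivial_on_cosets k)) \<longlonglongrightarrow> d"
    and "d \<ge> dc_finite k (G Mod H) - 2 ^ Suc k * (dc_finite k (G Mod H) - dc_finite k (G Mod N))"
    and "\<And>n. trivial_on_cosets k \<in> sets (Pi\<^sub>M {..k} (\<lambda>_. M n))"
proof -
  interpret N: normal N G by fact
  let ?Q = "G Mod N" and ?W = "{..k} \<rightarrow>\<^sub>E carrier (G Mod N)"
  define K where "K = (\<lambda>x. N #> x) ` H"
  have K: "K \<lhd> ?Q"
    unfolding K_def by (rule surj_hom_normal_subgroup[OF N.group_hom_Mod]) (simp add: carrier_FactGroup)
  interpret K: normal K ?Q by fact
  have K_mem: "N #> x \<in> K \<longleftrightarrow> x \<in> H" if x: "x \<in> carrier G" for x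
  proof
    assume "N #> x \<in> K"
    then obtain h where h: "h \<in> H" "N #> x = N #> h" by (auto simp: K_def)
    have "x \<in> N #> x" by (rule rcos_self[OF x N.subgroup_axioms])
    then obtain n where "n \<in> N" "x = n \<otimes> h" using h by (auto simp: r_coset_def)
    then show "x \<in> H" using h NH by auto
  qed (auto simp: K_def)
  define E where "E = {X \<in> ?W. simple_commutator ?Q X k = N}"
  define A where "A = {X \<in> ?W. simple_commutator ?Q X k \<in> K}"
  define D where "D = {X \<in> ?W. \<forall>h \<in> {..k} \<rightarrow>\<^sub>E K. simple_commutator ?Q (\<lambda>i. X i <#> h i) k = N}"
  let ?c = "real (card (carrier ?Q) ^ Suc k)"
  have "card E * 2 ^ Suc k + card A \<le> card A * 2 ^ Suc k + card D"
    using K.card_simple_commutator_trivial[OF N.finite_carrier_Mod[OF fin], of k]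
    by (simp add: E_def A_def D_def)
  then have "real (card E * 2 ^ Suc k + card A) \<le> real (card A * 2 ^ Suc k + card D)"
    by (rule of_nat_mono)
  then have "(real (card E) * 2 ^ Suc k + card A) / ?c \<le> (real (card A) * 2 ^ Suc k + card D) / ?c"
    by (intro divide_right_mono) auto
  then have card_le: "card A / ?c - 2 ^ Suc k * (card A / ?c - card E / ?c) \<le> card D / ?c"
    by (simp add: add_divide_distrib algebra_simps)
  have hom: "simple_commutator ?Q (\<lambda>i \<in> {..k}. N #> x i) k = N #> simple_commutator G x k"
    and restr: "(\<lambda>i \<in> {..k}. N #> x i) \<in> ?W" if x: "\<And>i. i \<le> k \<Longrightarrow> x i \<in> carrier G" for x
  proof -
    have "N #> simple_commutator G x k = simple_commutator ?Q (\<lambda>i. N #> x i) k"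
      by (rule group_hom.hom_simple_commutator[OF N.group_hom_Mod]) (rule x)
    also have "\<dots> = simple_commutator ?Q (\<lambda>i \<in> {..k}. N #> x i) k"
      by (rule simple_commutator_cong) simp
    finally show "simple_commutator ?Q (\<lambda>i \<in> {..k}. N #> x i) k = N #> simple_commutator G x k" ..
    show "(\<lambda>i \<in> {..k}. N #> x i) \<in> ?W"
      using x by (auto simp: carrier_FactGroup)
  qed
  have preA: "coset_preimage G N k A = {x \<in> {..k} \<rightarrow>\<^sub>E carrier G. simple_commutator G x k \<in> H}"
  proof -
    have "(\<lambda>i \<in> {..k}. N #> x i) \<in> A \<longleftrightarrow> simple_commutator G x k \<in> H"
      if "x \<in> {..k} \<rightarrow>\<^sub>E carrier G" for x
    proof -
      have xi: "\<And>i. i \<le> k \<Longrightarrow> x i \<in> carrier G" using that by auto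
      show ?thesis
        using hom[OF xi] restr[OF xi] K_mem[OF simple_commutator_closed[OF xi]]
        by (simp add: A_def del: restrict_apply)
    qed
    then show ?thesis by (auto simp: coset_preimage_def simp del: restrict_apply)
  qed
  have preD: "coset_preimage G N k D = trivial_on_cosets k"
  proof -
    have *: "(\<lambda>i \<in> {..k}. N #> x i) \<in> D \<longleftrightarrow>
        (\<forall>h \<in> {..k} \<rightarrow>\<^sub>E H. simple_commutator G (\<lambda>i. x i \<otimes> h i) k \<in> N)" (is "?L \<longleftrightarrow> ?R")
      if "x \<in> {..k} \<rightarrow>\<^sub>E carrier G" for x
    proof -
      have xi: "x i \<in> carrier G" if "i \<le> k" for i using \<open>x \<in> _\<close> that by auto
      \<comment> \<open>Here \<open>h\<close> lifts \<open>g\<close> to \<open>H\<close>, so testing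
        all of \<open>K\<close> in \<open>G/N\<close> amounts to testing all of \<open>H\<close>
        modulo \<open>N\<close>.\<close>
      have eq: "simple_commutator ?Q (\<lambda>i. (\<lambda>i \<in> {..k}. N #> x i) i <#> g i) k = N \<longleftrightarrow>
          simple_commutator G (\<lambda>i. x i \<otimes> h i) k \<in> N"
        if h: "\<And>i. i \<le> k \<Longrightarrow> h i \<in> H" and g: "\<And>i. i \<le> k \<Longrightarrow> g i = N #> h i" for h g
      proof -
        have "simple_commutator ?Q (\<lambda>i. (\<lambda>i \<in> {..k}. N #> x i) i <#> g i) k =
            simple_commutator ?Q (\<lambda>i. N #> (x i \<otimes> h i)) k"
          using h g xi by (intro simple_commutator_cong) (simp add: N.rcos_sum)
        moreover have "simple_commutator G (\<lambda>i. x i \<otimes> h i) k \<in> N \<longleftrightarrow>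
            simple_commutator ?Q (\<lambda>i. N #> (x i \<otimes> h i)) k = N"
          using xi h by (intro N.simple_commutator_mem_iff) auto
        ultimately show ?thesis by simp
      qed
      show ?thesis
      proof
        assume L: ?L
        show ?R
        proof
          fix h assume h: "h \<in> {..k} \<rightarrow>\<^sub>E H"
          then have "(\<lambda>i \<in> {..k}. N #> h i) \<in> {..k} \<rightarrow>\<^sub>E K" by (auto simp: K_def)
          then have "simple_commutator ?Q (\<lambda>i. (\<lambda>i \<in> {..k}. N #> x i) i <#> (\<lambda>i \<in> {..k}. N #> h i) i) k = N"
            using L unfolding D_def by blast
          moreover have "\<And>i. i \<le> k \<Longrightarrow> h i \<in> H" using h by auto
          ultimately show "simple_commutator G (\<lambda>i. x i \<otimes> h i) k \<in> N"
            using eq[of h "\<lambda>i \<in> {..k}. N #> h i"] by (simp del: restrict_apply add: restrict_apply')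
        qed
      next
        assume R: ?R
        show ?L
          unfolding D_def
        proof (intro CollectI conjI ballI)
          show "(\<lambda>i \<in> {..k}. N #> x i) \<in> ?W" by (rule restr) (rule xi)
          fix g assume g: "g \<in> {..k} \<rightarrow>\<^sub>E K"
          then have "\<forall>i \<in> {..k}. \<exists>h. h \<in> H \<and> g i = N #> h" by (auto simp: K_def PiE_iff)
          then obtain h where h: "\<And>i. i \<in> {..k} \<Longrightarrow> h i \<in> H \<and> g i = N #> h i" by metis
          have "restrict h {..k} \<in> {..k} \<rightarrow>\<^sub>E H" using h by auto
          then have "simple_commutator G (\<lambda>i. x i \<otimes> restrict h {..k} i) k \<in> N" using R by blast
          then show "simple_commutator ?Q (\<lambda>i. (\<lambda>i \<in> {..k}. N #> x i) i <#> g i) k = N"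
            using eq[of "restrict h {..k}" g] h by simp
        qed
      qed
    qed
    have triv: "(\<forall>h \<in> {..k} \<rightarrow>\<^sub>E H. simple_commutator G (\<lambda>i. x i \<otimes> h i) k \<in> N) \<longleftrightarrow> x \<in> trivial_on_cosets k"
      if "x \<in> {..k} \<rightarrow>\<^sub>E carrier G" for x
      using stable[OF that] N.one_closed by (auto simp: trivial_on_cosets_def)
    have "trivial_on_cosets k \<subseteq> {..k} \<rightarrow>\<^sub>E carrier G" by (auto simp: trivial_on_cosets_def)
    then show ?thesis
      using * triv by (auto simp: coset_preimage_def simp del: restrict_apply)
  qed
  have sub: "A \<subseteq> ?W" "D \<subseteq> ?W" by (auto simp: A_def D_def)
  note lim = N.tendsto_measure_coset_preimage[OF M idx fin]
  \<comment> \<open>Both sides are limits of the same probabilities, computed once with cosets of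
    \<open>N\<close> and once with cosets of \<open>H\<close>. This avoids counting through the
    isomorphism of \<open>G/H\<close> with \<open>(G/N)/(H/N)\<close>.\<close>
  have "card A / ?c = dc_finite k (G Mod H)"
    using lim[OF sub(1)] tendsto_dc_finite_Mod[OF M idx finH, of k] unfolding preA
    by (intro LIMSEQ_unique) auto
  moreover have "card E / ?c = dc_finite k (G Mod N)"
    by (simp add: N.dc_finite_Mod[OF fin] E_def)
  ultimately show thesis
    using that[of "card D / ?c"] lim[OF sub(2)] card_le N.coset_preimage_sets(1)[OF M fin sub(2)]
    unfolding preD by simp
qed

end

section \<open>Passing to the limit\<close>

text \<open>There are finitely many product cosets of \<open>H^(k + 1)\<close>. On each where the
  commutator is not identically trivial, some nontrivial value avoids some \<open>L l\<close>; the
  largest of these levels serves all of them.\<close>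

lemma (in normal) exists_detecting_level:
  assumes fin: "finite_index G H"
    and L: "\<And>l. L l \<lhd> G" "\<And>l. L (Suc l) \<subseteq> L l" "(\<Inter>l. L l) = {\<one>}"
  shows "\<exists>l \<ge> m. \<forall>x \<in> {..k} \<rightarrow>\<^sub>E carrier G.
    (\<forall>h \<in> {..k} \<rightarrow>\<^sub>E H. simple_commutator G (\<lambda>i. x i \<otimes> h i) k \<in> L l) \<longrightarrow> x \<in> trivial_on_cosets k"
proof -
  let ?W = "{..k} \<rightarrow>\<^sub>E carrier (G Mod H)"
  have antimono: "L j \<subseteq> L i" if "i \<le> j" for i j
    using L(2) that by (rule lift_Suc_antimono_le)
  have "\<exists>l. (\<forall>y \<in> Pi\<^sub>E {..k} X. simple_commutator G y k = \<one>) \<or>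
      (\<exists>y \<in> Pi\<^sub>E {..k} X. simple_commutator G y k \<notin> L l)" for X
    using L(3) by blast
  then obtain l where l: "\<And>X. (\<forall>y \<in> Pi\<^sub>E {..k} X. simple_commutator G y k = \<one>) \<or>
      (\<exists>y \<in> Pi\<^sub>E {..k} X. simple_commutator G y k \<notin> L (l X))"
    by metis
  have "finite ?W"
    using finite_carrier_Mod[OF fin] by (simp add: finite_PiE)
  \<comment> \<open>Inserting \<open>m\<close> forces \<open>m \<le> n\<close>. Where the commutator
    is trivial on the whole box, the choice of \<open>l X\<close> is arbitrary and harmless.\<close>
  define n where "n = Max (insert m (l ` ?W))"
  have n: "m \<le> n" "\<And>X. X \<in> ?W \<Longrightarrow> l X \<le> n"
    using \<open>finite ?W\<close> by (auto simp: n_def)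
  have "x \<in> trivial_on_cosets k"
    if x: "x \<in> {..k} \<rightarrow>\<^sub>E carrier G"
      and mem: "\<forall>h \<in> {..k} \<rightarrow>\<^sub>E H. simple_commutator G (\<lambda>i. x i \<otimes> h i) k \<in> L n" for x
  proof -
    let ?X = "\<lambda>i \<in> {..k}. H #> x i"
    have X: "?X \<in> ?W" using x by (auto simp: carrier_FactGroup)
    have PiE_X: "Pi\<^sub>E {..k} ?X = Pi\<^sub>E {..k} (\<lambda>i. H #> x i)"
      by (rule PiE_cong) simp
    have restr: "simple_commutator G (\<lambda>i \<in> {..k}. x i \<otimes> h i) k =
        simple_commutator G (\<lambda>i. x i \<otimes> h i) k" for h
      by (rule simple_commutator_cong) simp
    have "simple_commutator G y k \<in> L (l ?X)" if "y \<in> Pi\<^sub>E {..k} ?X" for y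
    proof -
      obtain h where "h \<in> {..k} \<rightarrow>\<^sub>E H" "y = (\<lambda>i \<in> {..k}. x i \<otimes> h i)"
        using \<open>y \<in> _\<close> mem_PiE_cosets_iff[OF x] unfolding PiE_X by blast
      then have "simple_commutator G y k \<in> L n" using mem restr by simp
      then show ?thesis using antimono[OF n(2)[OF X]] by blast
    qed
    then have one: "\<forall>y \<in> Pi\<^sub>E {..k} (\<lambda>i. H #> x i). simple_commutator G y k = \<one>"
      using l[of ?X] unfolding PiE_X by blast
    have "simple_commutator G (\<lambda>i. x i \<otimes> h i) k = \<one>" if "h \<in> {..k} \<rightarrow>\<^sub>E H" for h
      using one mem_PiE_cosets_iff[OF x] that restr[of h] by metis
    then show ?thesis using x by (simp add: trivial_on_cosets_def)
  qed
  then show ?thesis using n(1) by blast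
qed

theorem corollary1p15:
  fixes G :: "('a, 'b) monoid_scheme"
    and M :: "nat \<Rightarrow> 'a measure"
    and H :: "nat \<Rightarrow> 'a set"
    and k :: nat
  assumes "k \<ge> 1"
    and "group G"
    and "residually_finite G"
    and "\<And>n. prob_measure_on G (M n)"
    and "measures_index_uniformly G M"
    and "\<And>m. H m \<lhd> G"
    and "\<And>m. finite_index G (H m)"
    and "\<And>m. H (Suc m) \<subset> H m"
    and "(\<Inter>m. H m) = {\<one>\<^bsub>G\<^esub>}"
  shows "(\<lambda>m. ereal (dc_finite k (G Mod H m))) \<longlonglongrightarrow> dc_limsup k M G"
proof -
  interpret group G by fact
  interpret H: normal "H m" G for m by (rule assms(6))
  note M = assms(4) and idx = assms(5) and fin = assms(7)
  define P where "P n = Pi\<^sub>M {..k} (\<lambda>_. M n)" for n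
  define p where "p m = dc_finite k (G Mod H m)" for m
  define W where "W = ({..k} \<rightarrow>\<^sub>E carrier G)"
  define A where "A m = {x \<in> W. simple_commutator G x k \<in> H m}" for m
  define E where "E = {x \<in> W. simple_commutator G x k = \<one>\<^bsub>G\<^esub>}"
  define D where "D n = dc_measure k (M n) G" for n
  have antimono: "H j \<subseteq> H i" if "i \<le> j" for i j
    using that by (rule lift_Suc_antimono_le[rotated]) (use assms(8) in blast)
  have prob: "prob_space (P n)" for n
    unfolding P_def using M by (intro prob_space_PiM) (simp add: prob_measure_on_def)
  have space: "space (P n) = W" for n
    using M by (simp add: P_def W_def space_PiM prob_measure_on_def)
  have D: "D n = measure (P n) E" for n
    using space[of n] by (simp add: D_def dc_measure_def P_def E_def)
  have A_sets: "A m \<in> sets (P n)" for m n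
    unfolding A_def P_def W_def by (rule H.commutator_event_sets[OF M fin])
  \<comment> \<open>This makes \<open>E\<close> measurable even for uncountable \<open>G\<close>: it
    is a countable intersection of events decided by cosets.\<close>
  have "E = (\<Inter>m. A m)"
    using assms(9) by (auto simp: A_def E_def)
  then have E_sets: "E \<in> sets (P n)" for n
    using A_sets by (auto intro: sets.countable_INT)
  have mono: "measure (P n) X \<le> measure (P n) Y" if "X \<subseteq> Y" "Y \<in> sets (P n)" for X Y n
    using finite_measure.finite_measure_mono[OF prob_space.finite_measure[OF prob]] that by blast
  have lim_A: "(\<lambda>n. measure (P n) (A m)) \<longlonglongrightarrow> p m" for m
    unfolding P_def A_def p_def W_def by (rule H.tendsto_dc_finite_Mod[OF M idx fin])
  have "decseq p"
  proof (rule decseq_SucI)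
    fix m
    have "A (Suc m) \<subseteq> A m"
      using antimono[of m "Suc m"] by (auto simp: A_def)
    then show "p (Suc m) \<le> p m"
      using mono[OF _ A_sets] by (intro LIMSEQ_le[OF lim_A lim_A]) blast
  qed
  moreover have "p m \<ge> 0" for m
    by (simp add: p_def dc_finite_def dc_measure_def)
  ultimately obtain \<alpha> where \<alpha>: "p \<longlonglongrightarrow> \<alpha>" "\<And>m. \<alpha> \<le> p m"
    using decseq_convergent by blast
  \<comment> \<open>The detecting level \<open>l\<close> depends on \<open>m\<close>; since
    \<open>\<alpha> \<le> p l\<close>, the bound in terms of \<open>p l\<close> weakens to one in
    which \<open>l\<close> no longer occurs.\<close>
  have "\<exists>d. (\<lambda>n. measure (P n) (H.trivial_on_cosets m k)) \<longlonglongrightarrow> d \<and>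
      d \<ge> p m - 2 ^ Suc k * (p m - \<alpha>)" for m
  proof -
    have "\<exists>l \<ge> m. \<forall>x \<in> {..k} \<rightarrow>\<^sub>E carrier G.
        (\<forall>h \<in> {..k} \<rightarrow>\<^sub>E H m. simple_commutator G (\<lambda>i. x i \<otimes>\<^bsub>G\<^esub> h i) k \<in> H l) \<longrightarrow>
        x \<in> H.trivial_on_cosets m k"
      by (rule H.exists_detecting_level[OF fin assms(6) psubset_imp_subset[OF assms(8)] assms(9)])
    then obtain l where l: "m \<le> l" "\<forall>x \<in> {..k} \<rightarrow>\<^sub>E carrier G.
        (\<forall>h \<in> {..k} \<rightarrow>\<^sub>E H m. simple_commutator G (\<lambda>i. x i \<otimes>\<^bsub>G\<^esub> h i) k \<in> H l) \<longrightarrow>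
        x \<in> H.trivial_on_cosets m k"
      by (elim exE conjE)
    have stable: "x \<in> H.trivial_on_cosets m k" if "x \<in> {..k} \<rightarrow>\<^sub>E carrier G"
      and "\<And>h. h \<in> {..k} \<rightarrow>\<^sub>E H m \<Longrightarrow> simple_commutator G (\<lambda>i. x i \<otimes>\<^bsub>G\<^esub> h i) k \<in> H l" for x
      using l(2) that by (simp add: Ball_def)
    obtain d where "(\<lambda>n. measure (P n) (H.trivial_on_cosets m k)) \<longlonglongrightarrow> d"
      and d: "d \<ge> p m - 2 ^ Suc k * (p m - p l)"
    proof (rule H.density_lower_bound[OF assms(6)[of l] fin antimono[OF l(1)] fin M idx stable])
      fix d assume "(\<lambda>n. measure (Pi\<^sub>M {..k} (\<lambda>_. M n)) (H.trivial_on_cosets m k)) \<longlonglongrightarrow> d"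
        and "d \<ge> dc_finite k (G Mod H m) -
          2 ^ Suc k * (dc_finite k (G Mod H m) - dc_finite k (G Mod H l))"
      then show thesis by (intro that[of d]) (simp_all only: P_def p_def)
    qed
    moreover have "2 ^ Suc k * (p m - p l) \<le> 2 ^ Suc k * (p m - \<alpha>)"
      using \<alpha>(2)[of l] by (intro mult_left_mono) auto
    ultimately show ?thesis using d by (intro exI[of _ d] conjI) linarith+
  qed
  then obtain d where d: "\<And>m. (\<lambda>n. measure (P n) (H.trivial_on_cosets m k)) \<longlonglongrightarrow> d m"
      "\<And>m. d m \<ge> p m - 2 ^ Suc k * (p m - \<alpha>)"
    by metis
  have trivial_E: "H.trivial_on_cosets m k \<subseteq> E" for m
  proof
    fix x assume x: "x \<in> H.trivial_on_cosets m k"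
    then have W: "x \<in> W" by (simp add: H.trivial_on_cosets_def W_def)
    have "(\<lambda>i \<in> {..k}. \<one>\<^bsub>G\<^esub>) \<in> {..k} \<rightarrow>\<^sub>E H m" by auto
    then have "simple_commutator G (\<lambda>i. x i \<otimes>\<^bsub>G\<^esub> (\<lambda>i \<in> {..k}. \<one>\<^bsub>G\<^esub>) i) k = \<one>\<^bsub>G\<^esub>"
      using x unfolding H.trivial_on_cosets_def by blast
    moreover have "simple_commutator G (\<lambda>i. x i \<otimes>\<^bsub>G\<^esub> (\<lambda>i \<in> {..k}. \<one>\<^bsub>G\<^esub>) i) k = simple_commutator G x k"
      using W by (intro simple_commutator_cong) (auto simp: W_def PiE_iff)
    ultimately show "x \<in> E" using W by (simp add: E_def)
  qed
  \<comment> \<open>The probabilities of a trivial commutator actually converge, so their upper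
    limit is the limit of \<open>p\<close>.\<close>
  have "D \<longlonglongrightarrow> \<alpha>"
  proof (rule decseq_tendsto_unique_between[OF \<alpha>(1), of "2 ^ Suc k" D d])
    fix m and e :: real assume e: "e > 0"
    have le: "D n \<le> measure (P n) (A m)" for n
      unfolding D by (rule mono[OF _ A_sets]) (auto simp: A_def E_def)
    have "\<forall>\<^sub>F n in sequentially. measure (P n) (A m) < p m + e"
      using lim_A by (rule order_tendstoD) (use e in simp)
    then show "\<forall>\<^sub>F n in sequentially. D n < p m + e"
      by (rule eventually_mono) (rule order.strict_trans1[OF le])
    have ge: "measure (P n) (H.trivial_on_cosets m k) \<le> D n" for n
      unfolding D by (rule mono[OF trivial_E E_sets])
    have "\<forall>\<^sub>F n in sequentially. measure (P n) (H.trivial_on_cosets m k) > d m - e"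
      using d(1) by (rule order_tendstoD) (use e in simp)
    then show "\<forall>\<^sub>F n in sequentially. D n > d m - e"
      by (rule eventually_mono) (rule order.strict_trans2[OF _ ge])
  qed (simp, rule d(2))
  then have "limsup (\<lambda>n. ereal (D n)) = ereal \<alpha>"
    by (intro lim_imp_Limsup) auto
  then show ?thesis
    using \<alpha>(1) by (simp add: dc_limsup_def D_def p_def[abs_def])
qed

end
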